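(* Let $\Sigma=\{0,1\}$ and let $(p_{ij})_{i,j\in\Sigma}$ be a transition matrix with $p_{ij}\in(0,1)$ for all $i,j\in\Sigma$ and $p_{ij}\neq \tfrac12$ for some $(i,j)\in\Sigma^2$. Let $\mu=\mu_0\delta_0+\mu_1\delta_1$ be any probability distribution on $\Sigma$, and let $B_n^\mu$ be the number of bucket operations of radix sort (equivalently, the external path length of the trie) built from $n$ independent strings generated by the Markov source with initial distribution $\mu$ and transition matrix $(p_{ij})$. Then, as $n\to\infty$, $$\mathbb{E}[B_n^\mu]=\frac1H n\log n+O(n),\qquad \operatorname{Var}(B_n^\mu)=\sigma^2 n\log n+O\big(n\sqrt{\log n}\big),$$ where $$\sigma^2=\frac{\pi_0 p_{00}p_{01}}{H^3}\Big(\log(p_{00}/p_{01})+\frac{H_1-H_0}{p_{01}+p_{10}}\Big)^2+\frac{\pi_1 p_{10}p_{11}}{H^3}\Big(\log(p_{10}/p_{11})+\frac{H_1-H_0}{p_{01}+p_{10}}\Big)^2.$$ Moreover, $$\frac{B_n^\mu-\mathbb{E}[B_n^\mu]}{\sqrt{\operatorname{Var}(B_n^\mu)}}\xrightarrow{d}\mathcal N(0,1).$$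
   Context: Markov source: each string $\xi_1\xi_2\xi_3\ldots\in\Sigma^{\mathbb N}$ is the sequence of states of a homogeneous Markov chain with $\mathbb P(\xi_1=j)=\mu_j$ and $\mathbb P(\xi_{k+1}=j\mid \xi_k=i)=p_{ij}$; the $n$ strings are i.i.d. The number of bucket operations is $B_n^\mu=\sum_{j=1}^n D_j$, where $D_j$ is the smallest $k\ge0$ such that no other of the $n$ strings has the same first $k$ symbols as string $j$ (so $B_0^\mu=B_1^\mu=0$; equivalently, for $n\ge2$ one inspects the first symbol of each string, splits into two buckets, and recurses on the remaining suffixes, counting $n$ operations per split). Stationary distribution: $\pi_0=p_{10}/(p_{01}+p_{10})$, $\pi_1=p_{01}/(p_{01}+p_{10})$. Entropies: $H_i=-\sum_{j\in\Sigma}p_{ij}\log p_{ij}$ and entropy rate $H=\pi_0H_0+\pi_1H_1$. $\log$ is the natural logarithm. *)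

theory Defs
  imports "HOL-Probability.Probability" "HOL-Library.Landau_Symbols"
begin

text \<open>Alphabet Sigma = {0,1} is represented by bool: symbol 0 = False, symbol 1 = True.
  Transition matrix p i j = P(next = j | current = i). Strings are indexed from position 0.\<close>

definition entropy_row :: "(bool \<Rightarrow> bool \<Rightarrow> real) \<Rightarrow> bool \<Rightarrow> real" where
  "entropy_row p i = - (\<Sum>j\<in>UNIV. p i j * ln (p i j))"

definition stat0 :: "(bool \<Rightarrow> bool \<Rightarrow> real) \<Rightarrow> real" where
  "stat0 p = p True False / (p False True + p True False)"

definition stat1 :: "(bool \<Rightarrow> bool \<Rightarrow> real) \<Rightarrow> real" where
  "stat1 p = p False True / (p False True + p True False)"

definition entropy_rate :: "(bool \<Rightarrow> bool \<Rightarrow> real) \<Rightarrow> real" where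
  "entropy_rate p = stat0 p * entropy_row p False + stat1 p * entropy_row p True"

definition sigma2 :: "(bool \<Rightarrow> bool \<Rightarrow> real) \<Rightarrow> real" where
  "sigma2 p = (let H = entropy_rate p;
                   c = (entropy_row p True - entropy_row p False) / (p False True + p True False)
               in stat0 p * p False False * p False True / H ^ 3
                    * (ln (p False False / p False True) + c)\<^sup>2
                + stat1 p * p True False * p True True / H ^ 3
                    * (ln (p True False / p True True) + c)\<^sup>2)"

definition trie_depth :: "(nat \<Rightarrow> nat \<Rightarrow> bool) \<Rightarrow> nat \<Rightarrow> nat \<Rightarrow> nat" where
  "trie_depth x n j = (LEAST k. \<forall>j'<n. j' \<noteq> j \<longrightarrow> (\<exists>i<k. x j' i \<noteq> x j i))"

definition bucket_ops :: "(nat \<Rightarrow> nat \<Rightarrow> bool) \<Rightarrow> nat \<Rightarrow> nat" where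
  "bucket_ops x n = (\<Sum>j<n. trie_depth x n j)"

end

theory Submission
  imports Defs "HOL-Real_Asymp.Real_Asymp"
begin

text \<open>For a string \<open>z\<close> let \<open>\<tau>\<^sub>n(z)\<close> be the number of \<open>k\<close> with \<open>n p(z\<^sub>0,z\<^sub>1) \<cdots> p(z\<^sub>k\<^sub>-\<^sub>1,z\<^sub>k) \<ge> 1\<close>. The depth of
  the string in the trie differs from \<open>\<tau>\<^sub>n\<close> only at the few levels where the expected number of strings
  with the same prefix is of order one. Hence the difference between the number of bucket operations
  and the sum \<open>A\<^sub>n\<close> of \<open>\<tau>\<^sub>n\<close> over all strings has mean \<open>O(n)\<close> and, by the Efron--Stein inequality, variance
  \<open>O(n)\<close>. The sum \<open>A\<^sub>n\<close> consists of independent terms bounded by \<open>O(log n)\<close>, so it is asymptotically normal,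
  and \<open>H \<tau>\<^sub>n - log n\<close> is, up to \<open>O(1)\<close>, a stopped martingale with bounded increments whose variance is
  \<open>H\<^sup>2 \<sigma>\<^sup>2 log n + O(1)\<close>. By Cauchy--Schwarz the error in the variance is \<open>O(n \<surd>log n)\<close>.\<close>

section \<open>Second moments, product distributions and the Efron--Stein inequality\<close>

text \<open>The estimates are made for prefixes with \<open>L\<close> transitions: there all
  distributions have finite support, integrability is automatic and Efron--Stein is an induction
  over coordinates. The bounds do not depend on \<open>L\<close>, and this uniformity yields the
  finite second moments, the almost sure distinctness of the strings and the passage of
  \<open>L\<close> to infinity. At a level whose prefix has weight \<open>w\<close>, put
  \<open>a = n * w\<close>. Up to a factor from the initial law, \<open>a\<close> is the expected
  number of strings sharing the prefix, so the event that the level is shared and the test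
  \<open>a >= 1\<close> disagree with probability at most a constant times
  \<open>min a (1 / a)\<close>. As \<open>a\<close> decays geometrically along a string, these
  bounds are summable. The initial law thus affects only constants. Origin of the leading terms:
  under the stationary law one level lowers the logarithm of the threshold by \<open>H\<close> on
  average and contributes variance \<open>sigma2 p * H\<close>; about \<open>ln n / H\<close> levels
  are passed.\<close>

lemma integrable_mult_square:
  fixes X Y :: "'a \<Rightarrow> real"
  assumes [measurable]: "X \<in> borel_measurable M" "Y \<in> borel_measurable M"
    and "integrable M (\<lambda>x. (X x)\<^sup>2)" "integrable M (\<lambda>x. (Y x)\<^sup>2)"
  shows "integrable M (\<lambda>x. X x * Y x)"
proof (rule Bochner_Integration.integrable_bound)
  show "integrable M (\<lambda>x. (X x)\<^sup>2 + (Y x)\<^sup>2)"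
    using assms by auto
  have "\<bar>a * b\<bar> \<le> a\<^sup>2 + b\<^sup>2" for a b :: real
  proof -
    have "0 \<le> \<bar>a\<bar> * \<bar>b\<bar>" by simp
    moreover have "2 * \<bar>a\<bar> * \<bar>b\<bar> \<le> a\<^sup>2 + b\<^sup>2" using sum_squares_bound[of "\<bar>a\<bar>" "\<bar>b\<bar>"] by simp
    ultimately show ?thesis unfolding abs_mult by linarith
  qed
  then show "AE x in M. norm (X x * Y x) \<le> norm ((X x)\<^sup>2 + (Y x)\<^sup>2)"
    by auto
qed auto

lemma integrable_add_square:
  fixes X Y :: "'a \<Rightarrow> real"
  assumes [measurable]: "X \<in> borel_measurable M" "Y \<in> borel_measurable M"
    and "integrable M (\<lambda>x. (X x)\<^sup>2)" "integrable M (\<lambda>x. (Y x)\<^sup>2)"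
  shows "integrable M (\<lambda>x. (X x + Y x)\<^sup>2)"
  using assms integrable_mult_square[OF assms] by (simp add: power2_sum mult.assoc)

lemma cauchy_schwarz_integral:
  fixes X Y :: "'a \<Rightarrow> real"
  assumes [measurable]: "X \<in> borel_measurable M" "Y \<in> borel_measurable M"
    and X2: "integrable M (\<lambda>x. (X x)\<^sup>2)" and Y2: "integrable M (\<lambda>x. (Y x)\<^sup>2)"
  shows "\<bar>\<integral>x. X x * Y x \<partial>M\<bar> \<le> sqrt ((\<integral>x. (X x)\<^sup>2 \<partial>M) * (\<integral>x. (Y x)\<^sup>2 \<partial>M))"
proof -
  define a b c where "a = (\<integral>x. (X x)\<^sup>2 \<partial>M)" and "b = (\<integral>x. X x * Y x \<partial>M)" and "c = (\<integral>x. (Y x)\<^sup>2 \<partial>M)"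
  note XY = integrable_mult_square[OF assms]
  have q: "0 \<le> t\<^sup>2 * a + 2 * t * b + c" for t
  proof -
    have "0 \<le> (\<integral>x. (t * X x + Y x)\<^sup>2 \<partial>M)"
      by simp
    also have "\<dots> = (\<integral>x. (t\<^sup>2 * (X x)\<^sup>2 + 2 * t * (X x * Y x)) + (Y x)\<^sup>2 \<partial>M)"
      by (intro Bochner_Integration.integral_cong) (auto simp: power2_eq_square algebra_simps)
    also have "\<dots> = t\<^sup>2 * a + 2 * t * b + c"
      unfolding a_def b_def c_def using X2 Y2 XY by simp
    finally show ?thesis .
  qed
  have "b\<^sup>2 \<le> a * c"
  proof (cases "a = 0")
    case True
    have "b = 0"
    proof (rule ccontr)
      assume "b \<noteq> 0"
      \<comment> \<open>For \<open>a = 0\<close> the form is affine in \<open>t\<close>, and this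
        \<open>t\<close> gives it the value \<open>-1\<close>.\<close>
      with q[of "-(c + 1) / (2 * b)"] True show False
        by (simp add: field_simps)
    qed
    with True show ?thesis by simp
  next
    case False
    moreover have "a \<ge> 0" by (simp add: a_def)
    ultimately have "a > 0" by simp
    \<comment> \<open>\<open>- b / a\<close> is the minimiser of the quadratic.\<close>
    have "0 \<le> a * ((- b / a)\<^sup>2 * a + 2 * (- b / a) * b + c)"
      using q[of "- b / a"] \<open>a > 0\<close> by (intro mult_nonneg_nonneg) auto
    also have "\<dots> = a * c - b\<^sup>2"
      using \<open>a > 0\<close> by (simp add: field_simps power2_eq_square)
    finally show ?thesis by simp
  qed
  then have "\<bar>b\<bar> \<le> sqrt (a * c)"
    by (metis real_sqrt_abs real_sqrt_le_iff)
  then show ?thesis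
    unfolding a_def b_def c_def .
qed

context prob_space
begin

text \<open>Applied twice, with a main term \<open>X\<close> and a perturbation \<open>Y\<close> of
  smaller variance: for one string the orders are \<open>log n\<close> and \<open>1\<close>, for all
  strings \<open>n log n\<close> and \<open>n\<close>. The large variance enters the error only
  through the geometric mean of the two.\<close>

lemma variance_add_bound:
  fixes X Y :: "'a \<Rightarrow> real"
  assumes [measurable]: "X \<in> borel_measurable M" "Y \<in> borel_measurable M"
    and X2: "integrable M (\<lambda>x. (X x)\<^sup>2)" and Y2: "integrable M (\<lambda>x. (Y x)\<^sup>2)"
  shows "\<bar>variance (\<lambda>x. X x + Y x) - variance X\<bar> \<le> 2 * sqrt (variance X * variance Y) + variance Y"
proof -
  have iX: "integrable M X" and iY: "integrable M Y"
    using square_integrable_imp_integrable[of X] square_integrable_imp_integrable[of Y] X2 Y2 by auto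
  define U W where "U = (\<lambda>x. X x - expectation X)" and "W = (\<lambda>x. Y x - expectation Y)"
  have [measurable]: "U \<in> borel_measurable M" "W \<in> borel_measurable M"
    unfolding U_def W_def by auto
  have U2: "integrable M (\<lambda>x. (U x)\<^sup>2)" and W2: "integrable M (\<lambda>x. (W x)\<^sup>2)"
    unfolding U_def W_def using X2 Y2 iX iY by (auto simp: power2_diff)
  have UW: "integrable M (\<lambda>x. U x * W x)"
    by (rule integrable_mult_square) (auto simp: U2 W2)
  have "variance (\<lambda>x. X x + Y x) = expectation (\<lambda>x. ((U x)\<^sup>2 + 2 * (U x * W x)) + (W x)\<^sup>2)"
    using iX iY by (intro Bochner_Integration.integral_cong) (auto simp: U_def W_def power2_eq_square algebra_simps)
  also have "\<dots> = expectation (\<lambda>x. (U x)\<^sup>2) + 2 * expectation (\<lambda>x. U x * W x) + expectation (\<lambda>x. (W x)\<^sup>2)"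
    using U2 W2 UW by simp
  finally have eq: "variance (\<lambda>x. X x + Y x) - variance X = 2 * expectation (\<lambda>x. U x * W x) + variance Y"
    unfolding U_def W_def by simp
  have "\<bar>expectation (\<lambda>x. U x * W x)\<bar> \<le> sqrt (variance X * variance Y)"
    using cauchy_schwarz_integral[of U M W] U2 W2 unfolding U_def W_def by simp
  with eq variance_positive[of Y] show ?thesis by linarith
qed

lemma abs_expectation_le_sqrt:
  fixes X :: "'a \<Rightarrow> real"
  assumes [measurable]: "X \<in> borel_measurable M" and "integrable M (\<lambda>x. (X x)\<^sup>2)"
  shows "expectation (\<lambda>x. \<bar>X x\<bar>) \<le> sqrt (expectation (\<lambda>x. (X x)\<^sup>2))"
  using cauchy_schwarz_integral[of "\<lambda>x. \<bar>X x\<bar>" M "\<lambda>_. 1"] assms by (simp add: prob_space)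

end

section \<open>Products of finitely supported distributions\<close>

lemma expectation_bind_finite:
  fixes h :: "'b \<Rightarrow> real"
  assumes "finite (set_pmf p)" "\<And>x. x \<in> set_pmf p \<Longrightarrow> finite (set_pmf (f x))"
  shows "measure_pmf.expectation (p \<bind> f) h
    = measure_pmf.expectation p (\<lambda>a. measure_pmf.expectation (f a) h)"
  using assms by (subst pmf_expectation_bind[of "set_pmf p"]) (auto simp: integral_measure_pmf[of "set_pmf p" p])

lemma finite_set_Pi_pmf:
  assumes "finite A" "\<And>i. i \<in> A \<Longrightarrow> finite (set_pmf (q i))"
  shows "finite (set_pmf (Pi_pmf A d q))"
  by (rule finite_subset[OF set_Pi_pmf_subset']) (use assms in \<open>auto intro!: finite_PiE_dflt\<close>)

text \<open>Both orders of integration occur: with coordinate \<open>a\<close> innermost for the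
  conditional variances in Efron--Stein, and with \<open>a\<close> outermost for conditioning on one
  string.\<close>

lemma expectation_Pi_pmf_insert:
  fixes f :: "('i \<Rightarrow> 'b) \<Rightarrow> real"
  assumes "finite A" "a \<notin> A" "\<And>i. i \<in> insert a A \<Longrightarrow> finite (set_pmf (q i))"
  shows "measure_pmf.expectation (Pi_pmf (insert a A) d q) f
      = measure_pmf.expectation (q a) (\<lambda>y. measure_pmf.expectation (Pi_pmf A d q) (\<lambda>x. f (x(a := y))))"
    and "measure_pmf.expectation (Pi_pmf (insert a A) d q) f
      = measure_pmf.expectation (Pi_pmf A d q) (\<lambda>x. measure_pmf.expectation (q a) (\<lambda>y. f (x(a := y))))"
proof -
  note fin = finite_set_Pi_pmf[OF assms(1), of q d]
  have 1: "Pi_pmf (insert a A) d q = q a \<bind> (\<lambda>y. map_pmf (\<lambda>x. x(a := y)) (Pi_pmf A d q))"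
    using assms by (simp add: Pi_pmf_insert' map_pmf_def)
  show "measure_pmf.expectation (Pi_pmf (insert a A) d q) f
      = measure_pmf.expectation (q a) (\<lambda>y. measure_pmf.expectation (Pi_pmf A d q) (\<lambda>x. f (x(a := y))))"
    unfolding 1 using assms fin by (subst expectation_bind_finite) auto
  have 2: "Pi_pmf (insert a A) d q = Pi_pmf A d q \<bind> (\<lambda>x. map_pmf (\<lambda>y. x(a := y)) (q a))"
    using assms by (simp add: Pi_pmf_insert' map_pmf_def bind_commute_pmf[of "q a"])
  show "measure_pmf.expectation (Pi_pmf (insert a A) d q) f
      = measure_pmf.expectation (Pi_pmf A d q) (\<lambda>x. measure_pmf.expectation (q a) (\<lambda>y. f (x(a := y))))"
    unfolding 2 using assms fin by (subst expectation_bind_finite) auto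
qed

lemma expectation_pmf_mono:
  fixes f g :: "'a \<Rightarrow> real"
  assumes "finite (set_pmf p)" "\<And>x. x \<in> set_pmf p \<Longrightarrow> f x \<le> g x"
  shows "measure_pmf.expectation p f \<le> measure_pmf.expectation p g"
  by (intro integral_mono_AE integrable_measure_pmf_finite assms) (simp add: AE_measure_pmf_iff assms)

lemma second_moment_eq_variance:
  fixes f :: "'a \<Rightarrow> real"
  assumes "finite (set_pmf p)"
  shows "measure_pmf.expectation p (\<lambda>x. (f x - c)\<^sup>2)
    = measure_pmf.variance p f + (measure_pmf.expectation p f - c)\<^sup>2"
proof -
  note [simp] = integrable_measure_pmf_finite[OF assms]
  show ?thesis
    by (simp add: power2_diff algebra_simps) (simp add: power2_eq_square algebra_simps)
qed

text \<open>A conditional variance is the least conditional second moment about a quantity that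
  ignores the coordinate, so \<open>g i\<close> may be any such quantity; later it is the value
  after deleting string \<open>i\<close>. The induction splits the variance at coordinate
  \<open>a\<close> by the law of total variance.\<close>

theorem efron_stein:
  fixes f :: "('i \<Rightarrow> 'b) \<Rightarrow> real" and g :: "'i \<Rightarrow> ('i \<Rightarrow> 'b) \<Rightarrow> real"
  assumes "finite A" "\<And>i. i \<in> A \<Longrightarrow> finite (set_pmf (q i))"
    and "\<And>i x y. i \<in> A \<Longrightarrow> g i (x(i := y)) = g i x"
  shows "measure_pmf.variance (Pi_pmf A d q) f
    \<le> (\<Sum>i\<in>A. measure_pmf.expectation (Pi_pmf A d q) (\<lambda>x. (f x - g i x)\<^sup>2))"
  using assms
proof (induction A arbitrary: f g rule: finite_induct)
  case empty
  then show ?case by simp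
next
  case (insert a A)
  let ?P = "Pi_pmf A d q" and ?E = "measure_pmf.expectation"
  have fA: "\<And>i. i \<in> A \<Longrightarrow> finite (set_pmf (q i))" and fa: "finite (set_pmf (q a))"
    using insert.prems by auto
  note fP = finite_set_Pi_pmf[OF insert.hyps(1), of q d, OF fA]
  note [simp] = integrable_measure_pmf_finite[OF fa] integrable_measure_pmf_finite[OF fP]
  note ins = expectation_Pi_pmf_insert(2)[OF insert.hyps(1,2), of q d]
  \<comment> \<open>Averages over coordinate \<open>a\<close>; \<open>g' i\<close> still ignores
    coordinate \<open>i\<close>, so the induction hypothesis applies to \<open>m\<close> and
    \<open>g'\<close>.\<close>
  define m where "m x = ?E (q a) (\<lambda>y. f (x(a := y)))" for x
  define g' where "g' i x = ?E (q a) (\<lambda>y. g i (x(a := y)))" for i x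
  have ga: "g a (x(a := y)) = g a x" for x y
    using insert.prems(2) by blast
  define c where "c = ?E ?P m"
  have c: "?E (Pi_pmf (insert a A) d q) f = c"
    unfolding c_def m_def using insert.prems by (subst ins) auto
  have sq: "(?E (q a) (h :: _ \<Rightarrow> real))\<^sup>2 \<le> ?E (q a) (\<lambda>y. (h y)\<^sup>2)" for h
    using second_moment_eq_variance[OF fa, of h 0] measure_pmf.variance_positive[of "q a" h] by simp
  have "measure_pmf.variance (Pi_pmf (insert a A) d q) f
      = ?E ?P (\<lambda>x. ?E (q a) (\<lambda>y. (f (x(a := y)) - c)\<^sup>2))"
    unfolding c using insert.prems by (subst ins) auto
  also have "\<dots> = ?E ?P (\<lambda>x. measure_pmf.variance (q a) (\<lambda>y. f (x(a := y))) + (m x - c)\<^sup>2)"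
    unfolding m_def by (subst second_moment_eq_variance[OF fa, where c = c]) (rule refl)
  also have "\<dots> \<le> ?E ?P (\<lambda>x. ?E (q a) (\<lambda>y. (f (x(a := y)) - g a (x(a := y)))\<^sup>2) + (m x - c)\<^sup>2)"
  proof (rule expectation_pmf_mono[OF fP], assumption, rule add_mono[OF _ order_refl])
    fix x
    show "measure_pmf.variance (q a) (\<lambda>y. f (x(a := y))) \<le> ?E (q a) (\<lambda>y. (f (x(a := y)) - g a (x(a := y)))\<^sup>2)"
      using second_moment_eq_variance[OF fa, of "\<lambda>y. f (x(a := y))" "g a x"] ga by simp
  qed
  also have "\<dots> = ?E (Pi_pmf (insert a A) d q) (\<lambda>x. (f x - g a x)\<^sup>2) + measure_pmf.variance ?P m"
    using insert.prems by (subst ins) (auto simp: c_def)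
  also have "measure_pmf.variance ?P m \<le> (\<Sum>i\<in>A. ?E ?P (\<lambda>x. (m x - g' i x)\<^sup>2))"
  proof (rule insert.IH[OF fA])
    fix i x y assume "i \<in> A"
    with insert.hyps have "i \<noteq> a" by auto
    then show "g' i (x(i := y)) = g' i x"
      unfolding g'_def using insert.prems(2)[OF insertI2[OF \<open>i \<in> A\<close>]] by (simp only: fun_upd_twist[OF \<open>i \<noteq> a\<close>])
  qed
  also have "(\<Sum>i\<in>A. ?E ?P (\<lambda>x. (m x - g' i x)\<^sup>2))
      \<le> (\<Sum>i\<in>A. ?E (Pi_pmf (insert a A) d q) (\<lambda>x. (f x - g i x)\<^sup>2))"
  proof (rule sum_mono)
    fix i assume "i \<in> A"
    \<comment> \<open>Jensen, in the form \<open>sq\<close>: averaging \<open>f - g i\<close> over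
      coordinate \<open>a\<close> does not increase its mean square.\<close>
    have "?E ?P (\<lambda>x. (m x - g' i x)\<^sup>2) \<le> ?E ?P (\<lambda>x. ?E (q a) (\<lambda>y. (f (x(a := y)) - g i (x(a := y)))\<^sup>2))"
      unfolding m_def g'_def
      by (rule expectation_pmf_mono[OF fP]) (auto intro: sq simp flip: Bochner_Integration.integral_diff)
    also have "\<dots> = ?E (Pi_pmf (insert a A) d q) (\<lambda>x. (f x - g i x)\<^sup>2)"
      using insert.prems by (subst ins) auto
    finally show "?E ?P (\<lambda>x. (m x - g' i x)\<^sup>2) \<le> ?E (Pi_pmf (insert a A) d q) (\<lambda>x. (f x - g i x)\<^sup>2)" .
  qed
  finally show ?case using insert.hyps by simp
qed

text \<open>The bound is explicit because in the application the summands change with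
  \<open>n\<close> (a triangular array). Each factor has a third-order Taylor error
  \<open>|\<theta>|^3 / 6 * (b / s) / n\<close>, as the summands are at most \<open>b / s\<close>
  and have variance \<open>1 / n\<close>; the \<open>n\<close>-th powers of two numbers of modulus
  at most 1 differ by at most \<open>n\<close> times their difference.\<close>

lemma char_normalized_sum_Pi_pmf:
  fixes q :: "'b pmf" and t :: "'b \<Rightarrow> real" and \<theta> m v b :: real and n :: nat
  defines "m \<equiv> measure_pmf.expectation q t" and "v \<equiv> measure_pmf.variance q t"
  assumes fin: "finite (set_pmf q)" and v: "0 < v"
    and b: "\<And>y. y \<in> set_pmf q \<Longrightarrow> \<bar>t y - m\<bar> \<le> b"
    and n: "0 < n" "\<theta>\<^sup>2 \<le> 4 * n"
  shows "cmod (char (distr (measure_pmf (Pi_pmf {..<n} d (\<lambda>_. q))) borel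
      (\<lambda>x. ((\<Sum>j<n. t (x j)) - n * m) / sqrt (n * v))) \<theta>
      - of_real ((1 + (- \<theta>\<^sup>2 / 2) / n) ^ n)) \<le> \<bar>\<theta>\<bar> ^ 3 / 6 * (b / sqrt (n * v))"
proof -
  let ?P = "Pi_pmf {..<n} d (\<lambda>_. q)"
  define s where "s = sqrt (n * v)"
  have s: "s > 0" "s\<^sup>2 = n * v" using n v by (auto simp: s_def)
  define X where "X y = (t y - m) / s" for y
  note [simp] = integrable_measure_pmf_finite[OF fin]
  note ps = measure_pmf.prob_space_axioms
  have EX: "measure_pmf.expectation q X = 0"
    unfolding X_def by (simp add: m_def)
  have varX: "measure_pmf.variance q X = 1 / n"
    unfolding EX unfolding X_def using s n v by (simp add: power_divide field_simps) (simp add: v_def m_def)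
  let ?\<psi> = "char (distr (measure_pmf q) borel X) \<theta>"
  have "(\<lambda>x. ((\<Sum>j<n. t (x j)) - n * m) / sqrt (n * v)) = (\<lambda>x. \<Sum>j<n. X (x j))"
    by (simp add: X_def s_def sum_divide_distrib[symmetric] sum_subtractf)
  moreover have "char (distr (measure_pmf ?P) borel (\<lambda>x. \<Sum>j<n. X (x j))) \<theta>
      = (\<Prod>j<n. char (distr (measure_pmf ?P) borel (\<lambda>x. X (x j))) \<theta>)"
  proof (rule prob_space.char_distr_sum[OF ps])
    have "prob_space.indep_vars ?P (\<lambda>_. count_space UNIV) (\<lambda>j x. x j) {..<n}"
      by (rule indep_vars_Pi_pmf) simp
    then show "prob_space.indep_vars ?P (\<lambda>_. borel) (\<lambda>j x. X (x j)) {..<n}"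
      by (rule prob_space.indep_vars_compose2[OF ps]) simp
  qed
  moreover have "char (distr (measure_pmf ?P) borel (\<lambda>x. X (x j))) \<theta> = ?\<psi>" if "j < n" for j
  proof -
    have "q = map_pmf (\<lambda>x. x j) ?P"
      using that by (subst Pi_pmf_component) auto
    then have "?\<psi> = char (distr (measure_pmf (map_pmf (\<lambda>x. x j) ?P)) borel X) \<theta>"
      by simp
    then show ?thesis
      by (simp add: char_def integral_distr)
  qed
  ultimately have char_eq: "char (distr (measure_pmf ?P) borel
      (\<lambda>x. ((\<Sum>j<n. t (x j)) - n * m) / sqrt (n * v))) \<theta> = ?\<psi> ^ n"
    by simp
  have "cmod (?\<psi> - (1 - \<theta>\<^sup>2 * (1 / n) / 2))
      \<le> (\<theta>\<^sup>2 / 6) * measure_pmf.expectation q (\<lambda>x. min (6 * (X x)\<^sup>2) (\<bar>\<theta>\<bar> * \<bar>X x\<bar> ^ 3))"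
    using prob_space.char_approx3'[OF ps, of X q "1 / n" "distr (measure_pmf q) borel X" \<theta>] EX varX by simp
  also have "\<dots> \<le> (\<theta>\<^sup>2 / 6) * measure_pmf.expectation q (\<lambda>x. (\<bar>\<theta>\<bar> * (b / s)) * (X x)\<^sup>2)"
  proof (intro mult_left_mono expectation_pmf_mono fin)
    fix y assume "y \<in> set_pmf q"
    then have "\<bar>X y\<bar> \<le> b / s"
      using b[of y] s by (simp add: X_def divide_right_mono)
    then have "\<bar>X y\<bar> * (X y)\<^sup>2 \<le> b / s * (X y)\<^sup>2"
      by (rule mult_right_mono) simp
    then have "\<bar>\<theta>\<bar> * (\<bar>X y\<bar> * (X y)\<^sup>2) \<le> \<bar>\<theta>\<bar> * (b / s * (X y)\<^sup>2)"
      by (rule mult_left_mono) simp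
    then show "min (6 * (X y)\<^sup>2) (\<bar>\<theta>\<bar> * \<bar>X y\<bar> ^ 3) \<le> (\<bar>\<theta>\<bar> * (b / s)) * (X y)\<^sup>2"
      by (simp add: power3_eq_cube power2_eq_square mult.assoc)
  qed simp
  also have "\<dots> = \<bar>\<theta>\<bar> ^ 3 / 6 * (b / s) / n"
    using varX EX by (simp add: power3_eq_cube power2_eq_square abs_mult[symmetric] ac_simps)
  finally have *: "cmod (?\<psi> - of_real (1 + (- \<theta>\<^sup>2 / 2) / n)) \<le> \<bar>\<theta>\<bar> ^ 3 / 6 * (b / s) / n"
    by (simp add: mult.commute)
  \<comment> \<open>The hypothesis \<open>\<theta>\<^sup>2 <= 4 n\<close> keeps this number from
    falling below \<open>-1\<close>.\<close>
  have "\<bar>1 + (- \<theta>\<^sup>2 / 2) / n\<bar> \<le> 1"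
    using n by (simp add: abs_le_iff field_simps)
  then have le1: "cmod (of_real (1 + (- \<theta>\<^sup>2 / 2) / n)) \<le> 1"
    by (simp only: norm_of_real)
  interpret D: real_distribution "distr (measure_pmf q) borel X"
    by (rule prob_space.real_distribution_distr[OF ps]) simp
  have "cmod (?\<psi> ^ n - of_real (1 + (- \<theta>\<^sup>2 / 2) / n) ^ n) \<le> n * cmod (?\<psi> - of_real (1 + (- \<theta>\<^sup>2 / 2) / n))"
    by (intro norm_power_diff D.cmod_char_le_1 le1)
  also have "\<dots> \<le> n * (\<bar>\<theta>\<bar> ^ 3 / 6 * (b / s) / n)"
    using * by (rule mult_left_mono) simp
  finally show ?thesis
    unfolding char_eq using n by (simp add: s_def)
qed

text \<open>Monotone convergence for the squares. It serves for the truncated counts, which increase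
  with \<open>L\<close> and almost surely become constant.\<close>

lemma (in prob_space) monotone_square_limit:
  fixes T :: "nat \<Rightarrow> 'a \<Rightarrow> real" and U :: "'a \<Rightarrow> real"
  assumes U [measurable]: "U \<in> borel_measurable M"
    and int: "\<And>L. integrable M (\<lambda>x. (T L x)\<^sup>2)"
    and nonneg: "\<And>L x. 0 \<le> T L x" and mono: "\<And>L L' x. L \<le> L' \<Longrightarrow> T L x \<le> T L' x"
    and bounded: "\<And>L. expectation (\<lambda>x. (T L x)\<^sup>2) \<le> K"
    and lim: "AE x in M. \<forall>\<^sub>F L in sequentially. T L x = U x"
  shows "integrable M (\<lambda>x. (U x)\<^sup>2)"
proof -
  define S where "S L x = (T L x)\<^sup>2" for L x
  have S_int: "integrable M (S L)" for L unfolding S_def[abs_def] by (rule int)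
  have S_mono: "mono (\<lambda>L. S L x)" for x
    unfolding S_def by (intro monoI power_mono mono nonneg)
  define m2 where "m2 L = expectation (S L)" for L
  have "incseq m2"
  proof (rule monoI)
    fix x y :: nat assume "x \<le> y"
    then have "S x z \<le> S y z" for z
      using S_mono[of z] by (simp add: mono_def)
    then show "m2 x \<le> m2 y"
      unfolding m2_def by (rule integral_mono[OF S_int[of x] S_int[of y]])
  qed
  moreover have "\<forall>L. m2 L \<le> K"
    using bounded by (simp add: m2_def S_def[abs_def])
  ultimately obtain E2 where E2: "m2 \<longlonglongrightarrow> E2"
    by (rule incseq_convergent[of m2 K])
  have S_lim: "AE x in M. (\<lambda>L. S L x) \<longlonglongrightarrow> (U x)\<^sup>2"
    using lim
  proof eventually_elim
    case (elim x)
    then have "\<forall>\<^sub>F L in sequentially. S L x = (U x)\<^sup>2"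
      by (rule eventually_mono) (simp add: S_def)
    then show ?case by (rule tendsto_eventually)
  qed
  have Sm: "AE x in M. mono (\<lambda>L. S L x)" using S_mono by simp
  have U2: "(\<lambda>x. (U x)\<^sup>2) \<in> borel_measurable M" by measurable
  have E2': "(\<lambda>L. integral\<^sup>L M (S L)) \<longlonglongrightarrow> E2" using E2 by (simp add: m2_def[abs_def])
  show ?thesis
    by (rule integrable_monotone_convergence[of M S "\<lambda>x. (U x)\<^sup>2" E2, OF S_int Sm S_lim E2' U2])
qed

text \<open>Dominated convergence for \<open>R L\<close> and for its square, with dominating
  functions \<open>w\<close> and its square. The centring in the variance moves with
  \<open>L\<close>, so the variance is handled as second moment minus squared mean.\<close>

lemma (in prob_space) variance_limit_le:
  fixes R :: "nat \<Rightarrow> 'a \<Rightarrow> real" and Q w :: "'a \<Rightarrow> real"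
  assumes Q [measurable]: "Q \<in> borel_measurable M" and R [measurable]: "\<And>L. R L \<in> borel_measurable M"
    and [measurable]: "w \<in> borel_measurable M"
    and w: "integrable M (\<lambda>x. (w x)\<^sup>2)"
    and lim: "AE x in M. (\<lambda>L. R L x) \<longlonglongrightarrow> Q x" and dom: "\<And>L. AE x in M. \<bar>R L x\<bar> \<le> w x"
    and E: "\<And>L. N \<le> L \<Longrightarrow> \<bar>expectation (R L)\<bar> \<le> c1" and V: "\<And>L. N \<le> L \<Longrightarrow> variance (R L) \<le> c2"
  shows "integrable M Q" "\<bar>expectation Q\<bar> \<le> c1" "variance Q \<le> c2"
proof -
  have w1: "integrable M w" by (rule square_integrable_imp_integrable) (use w in auto)
  have dom': "AE x in M. norm (R L x) \<le> w x" for L using dom[of L] by simp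
  note dc1 = integral_dominated_convergence[of Q M R w, OF Q R w1 lim dom']
  have dc_int1: "integrable M Q" "integrable M (R L)" for L
    using integrable_dominated_convergence[of Q M R w, OF Q R w1 lim dom']
      integrable_dominated_convergence2[of Q M R w, OF Q R w1 lim dom'] by auto
  define S where "S L x = (R L x)\<^sup>2" for L x
  define P where "P x = (Q x)\<^sup>2" for x
  have [measurable]: "P \<in> borel_measurable M" "S L \<in> borel_measurable M" for L
    unfolding P_def[abs_def] S_def[abs_def] by measurable
  have limS: "AE x in M. (\<lambda>L. S L x) \<longlonglongrightarrow> P x"
    using lim unfolding S_def P_def by eventually_elim (rule tendsto_power)
  have domS: "AE x in M. norm (S L x) \<le> (w x)\<^sup>2" for L
    using dom[of L]
  proof eventually_elim
    case (elim x)
    then have "\<bar>R L x\<bar>\<^sup>2 \<le> (w x)\<^sup>2" by (intro power_mono) auto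
    then show ?case by (simp add: S_def)
  qed
  have Pm: "P \<in> borel_measurable M" and Sm: "S L \<in> borel_measurable M" for L by measurable
  note dc2 = integral_dominated_convergence[of P M S "\<lambda>x. (w x)\<^sup>2", OF Pm Sm w limS domS]
  have dc_int2: "integrable M P" "integrable M (S L)" for L
    using integrable_dominated_convergence[of P M S "\<lambda>x. (w x)\<^sup>2", OF Pm Sm w limS domS]
      integrable_dominated_convergence2[of P M S "\<lambda>x. (w x)\<^sup>2", OF Pm Sm w limS domS] by auto
  show "integrable M Q" by (rule dc_int1)
  have ev1: "\<forall>\<^sub>F L in sequentially. \<bar>expectation (R L)\<bar> \<le> c1"
    using E by (rule eventually_sequentiallyI)
  show "\<bar>expectation Q\<bar> \<le> c1"
    by (rule tendsto_upperbound[OF tendsto_rabs[OF dc1] ev1]) simp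
  have var: "variance (R L) = expectation (S L) - (expectation (R L))\<^sup>2" for L
    unfolding S_def using dc_int1(2)[of L] dc_int2(2)[of L, unfolded S_def[abs_def]] by (rule variance_eq)
  have varQ: "variance Q = expectation P - (expectation Q)\<^sup>2"
    unfolding P_def using dc_int1(1) dc_int2(1)[unfolded P_def[abs_def]] by (rule variance_eq)
  have "(\<lambda>L. expectation (S L) - (expectation (R L))\<^sup>2) \<longlonglongrightarrow> expectation P - (expectation Q)\<^sup>2"
    by (rule tendsto_diff[OF dc2 tendsto_power[OF dc1]])
  moreover have "\<forall>\<^sub>F L in sequentially. expectation (S L) - (expectation (R L))\<^sup>2 \<le> c2"
    using V unfolding var by (rule eventually_sequentiallyI)
  ultimately show "variance Q \<le> c2"
    unfolding varQ by (rule tendsto_upperbound) simp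
qed

section \<open>The transition matrix and its martingales\<close>

locale transition_matrix =
  fixes p :: "bool \<Rightarrow> bool \<Rightarrow> real"
  assumes p_pos: "0 < p i j" and p_less_1: "p i j < 1" and p_sum: "p i False + p i True = 1"
begin

lemma p_True: "p i True = 1 - p i False" and p_False: "p i False = 1 - p i True"
  using p_sum[of i] by simp_all

definition p_min :: real where
  "p_min = min (min (p False False) (p False True)) (min (p True False) (p True True))"

definition p_max :: real where
  "p_max = max (max (p False False) (p False True)) (max (p True False) (p True True))"

lemma p_min_pos: "0 < p_min" and p_min_le: "p_min \<le> p i j"
  using p_pos by (simp_all add: p_min_def) (cases i; cases j; simp)

lemma p_max_less_1: "p_max < 1" and p_max_ge: "p i j \<le> p_max" and p_max_pos: "0 < p_max"
proof -
  show "p i j \<le> p_max" for i j by (cases i; cases j; simp add: p_max_def)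
  from this[of True True] show "0 < p_max" using p_pos[of True True] by linarith
qed (use p_less_1 in \<open>simp add: p_max_def\<close>)

lemma entropy_row_eq: "entropy_row p i = - (p i False * ln (p i False) + p i True * ln (p i True))"
  by (simp add: entropy_row_def UNIV_bool)

lemma entropy_row_pos: "0 < entropy_row p i"
proof -
  have "p i j * ln (p i j) < 0" for j
    using p_pos[of i j] p_less_1[of i j] by (simp add: mult_pos_neg)
  from this[of False] this[of True] show ?thesis unfolding entropy_row_eq by linarith
qed

lemma stat_pos: "0 < stat0 p" "0 < stat1 p"
  unfolding stat0_def stat1_def by (intro divide_pos_pos add_pos_pos p_pos)+

lemma entropy_rate_pos: "0 < entropy_rate p"
  unfolding entropy_rate_def by (intro add_pos_pos mult_pos_pos stat_pos entropy_row_pos)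

abbreviation "H \<equiv> entropy_rate p"

text \<open>The functions \<open>potential\<close> and \<open>var_potential\<close> solve Poisson equations of the chain;
  subtracting them turns the depth and its conditional variances into martingales.\<close>

definition potential :: "bool \<Rightarrow> real" where
  "potential i = (if i then 0 else (1 - entropy_row p False / H) / p False True)"

text \<open>Change, in a transition from \<open>i\<close> to \<open>j\<close>, of the number of
  levels passed plus \<open>ln c / H\<close> plus the potential of the current state, where
  \<open>c\<close> is the threshold that each transition multiplies by \<open>p i j\<close>.\<close>

definition incr :: "bool \<Rightarrow> bool \<Rightarrow> real" where
  "incr i j = 1 + ln (p i j) / H + potential j - potential i"

definition incr_var :: "bool \<Rightarrow> real" where
  "incr_var i = p i False * (incr i False)\<^sup>2 + p i True * (incr i True)\<^sup>2"

definition var_potential :: "bool \<Rightarrow> real" where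
  "var_potential i = (if i then 0 else (incr_var False - sigma2 p * entropy_row p False) / p False True)"

lemma H_eq: "(p False True + p True False) * H = p True False * entropy_row p False + p False True * entropy_row p True"
proof -
  define s where "s = p False True + p True False"
  have "s > 0" using p_pos[of False True] p_pos[of True False] by (simp add: s_def)
  then show ?thesis unfolding entropy_rate_def stat0_def stat1_def s_def[symmetric]
    by (simp add: distrib_left)
qed

text \<open>The equation in state \<open>False\<close> dictates \<open>potential False\<close>. In
  state \<open>True\<close> it becomes the solvability condition that
  \<open>1 - entropy_row p i / H\<close> has stationary mean zero, which is
  \<open>H_eq\<close>.\<close>

lemma incr_mean: "p i False * incr i False + p i True * incr i True = 0"
proof -
  note H = entropy_rate_pos
  have *: "p i False * incr i False + p i True * incr i True
    = 1 - entropy_row p i / H + (p i False * potential False + p i True * potential True - potential i)"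
    unfolding incr_def entropy_row_eq p_True by (simp add: algebra_simps add_divide_distrib diff_divide_distrib)
  show ?thesis
  proof (cases i)
    case False
    define w a where "w = 1 - entropy_row p False / H" and "a = p False True"
    have "a > 0" using p_pos by (simp add: a_def)
    then have "w + ((1 - a) * (w / a) - w / a) = 0"
      by (simp add: left_diff_distrib diff_divide_distrib)
    with False show ?thesis
      unfolding * by (simp add: potential_def w_def a_def p_False)
  next
    case True
    define w z a b where "w = 1 - entropy_row p False / H" and "z = 1 - entropy_row p True / H"
      and "a = p False True" and "b = p True False"
    have "a > 0" using p_pos by (simp add: a_def)
    have wz: "H * w = H - entropy_row p False" "H * z = H - entropy_row p True"
      using H by (simp_all add: w_def z_def right_diff_distrib)
    have "H * (a * z + b * w) = a * (H * z) + b * (H * w)"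
      by (simp add: algebra_simps)
    also have "\<dots> = 0"
      using H_eq unfolding wz a_def b_def by (simp add: algebra_simps)
    finally have "a * z + b * w = 0" using H by simp
    then have "z + b * (w / a) = 0"
      using \<open>a > 0\<close> by (simp add: add_divide_eq_iff mult.commute)
    with True show ?thesis
      unfolding * by (simp add: potential_def w_def z_def a_def b_def)
  qed
qed

text \<open>A centred variable with two values \<open>x\<close>, \<open>y\<close> of probabilities
  \<open>a\<close>, \<open>b\<close> has variance \<open>a * b * (x - y)\<^sup>2\<close>.\<close>

lemma incr_var_eq:
  "incr_var i = p i False * p i True
    * (ln (p i False / p i True) / H + potential False - potential True)\<^sup>2"
proof -
  define x y where "x = incr i False" and "y = incr i True"
  have "p i False * x + p i True * y = 0"
    using incr_mean x_def y_def by simp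
  then have y: "x = p i True * (x - y)" "y = - p i False * (x - y)"
    unfolding p_True by (simp_all add: algebra_simps)
  have "incr_var i = p i False * (p i True * (x - y))\<^sup>2 + p i True * (- p i False * (x - y))\<^sup>2"
    unfolding incr_var_def x_def[symmetric] y_def[symmetric] using y by simp
  also have "\<dots> = p i False * p i True * (p i False + p i True) * (x - y)\<^sup>2"
    by (simp add: power2_eq_square algebra_simps)
  also have "x - y = ln (p i False / p i True) / H + potential False - potential True"
    using p_pos[of i False] p_pos[of i True] by (simp add: x_def y_def incr_def ln_div diff_divide_distrib)
  finally show ?thesis by (simp add: p_sum)
qed

text \<open>This is the origin of the quotient of entropies by
  \<open>p False True + p True False\<close> in \<open>sigma2\<close>: it is \<open>H\<close> times
  the jump of the potential.\<close>

lemma potential_diff: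
  "potential False - potential True = (entropy_row p True - entropy_row p False) / (p False True + p True False) / H"
proof -
  note H = entropy_rate_pos
  have s: "p False True + p True False > 0" using p_pos[of False True] p_pos[of True False] by simp
  define t a e f where "t = p False True + p True False" and "a = p False True"
    and "e = entropy_row p False" and "f = entropy_row p True"
  have "t * (H - e) = a * (f - e)"
    using H_eq by (simp add: algebra_simps t_def a_def e_def f_def)
  moreover have "t > 0" "a > 0" using s p_pos by (auto simp: t_def a_def)
  ultimately have "H - e = a * ((f - e) / t)"
    by (simp add: eq_divide_eq mult.commute)
  moreover have "1 - e / H = (H - e) / H" using H by (simp add: diff_divide_distrib)
  ultimately have "(1 - e / H) / a = (f - e) / t / H"
    using \<open>a > 0\<close> by simp
  then show ?thesis
    unfolding t_def a_def e_def f_def by (simp add: potential_def)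
qed

text \<open>Identifies \<open>sigma2\<close>: an average variance of \<open>sigma2 p * H\<close> per
  level, over about \<open>ln n / H\<close> levels, amounts to
  \<open>sigma2 p * ln n\<close>.\<close>

lemma incr_var_stationary: "stat0 p * incr_var False + stat1 p * incr_var True = sigma2 p * H"
proof -
  note H = entropy_rate_pos
  define c where "c = (entropy_row p True - entropy_row p False) / (p False True + p True False)"
  have *: "incr_var i = p i False * p i True * (ln (p i False / p i True) + c)\<^sup>2 / H\<^sup>2" for i
  proof -
    have "ln (p i False / p i True) / H + potential False - potential True
      = ln (p i False / p i True) / H + (potential False - potential True)" by simp
    also have "\<dots> = (ln (p i False / p i True) + c) / H"
      unfolding potential_diff c_def by (simp only: add_divide_distrib)
    finally show ?thesis
      unfolding incr_var_eq by (simp only: power_divide times_divide_eq_right)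
  qed
  have k: "s * (a * b * x / H\<^sup>2) = s * a * b / H ^ 3 * x * H" for s a b x :: real
    using H by (simp add: power3_eq_cube power2_eq_square)
  show ?thesis
    unfolding * sigma2_def Let_def c_def[symmetric] k distrib_right ..
qed

text \<open>The entropy occurs because a transition from \<open>i\<close> lowers \<open>ln c\<close>
  by \<open>entropy_row p i\<close> on average. The compensated term
  \<open>incr_var i - sigma2 p * entropy_row p i\<close> has stationary mean zero by
  \<open>incr_var_stationary\<close>, so its Poisson equation is solvable.\<close>

lemma var_potential_eq:
  "incr_var i - sigma2 p * entropy_row p i + (p i False * var_potential False + p i True * var_potential True)
    = var_potential i"
proof (cases i)
  case False
  define w a where "w = incr_var False - sigma2 p * entropy_row p False" and "a = p False True"
  have "a > 0" using p_pos by (simp add: a_def)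
  then have "w + (1 - a) * (w / a) = w / a"
    by (simp add: left_diff_distrib diff_divide_distrib)
  with False show ?thesis
    by (simp add: var_potential_def w_def a_def p_False)
next
  case True
  define s where "s = p False True + p True False"
  have s: "s > 0" using p_pos[of False True] p_pos[of True False] by (simp add: s_def)
  have "p True False * incr_var False + p False True * incr_var True = s * (stat0 p * incr_var False + stat1 p * incr_var True)"
    using s unfolding stat0_def stat1_def s_def[symmetric] by (simp add: field_simps)
  also have "\<dots> = sigma2 p * (s * H)"
    using incr_var_stationary by simp
  also have "s * H = p True False * entropy_row p False + p False True * entropy_row p True"
    unfolding s_def by (rule H_eq)
  finally have *: "p True False * incr_var False + p False True * incr_var True
    = sigma2 p * (p True False * entropy_row p False + p False True * entropy_row p True)" .
  define w z a b where "w = incr_var False - sigma2 p * entropy_row p False"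
    and "z = incr_var True - sigma2 p * entropy_row p True" and "a = p False True" and "b = p True False"
  have "a > 0" using p_pos by (simp add: a_def)
  moreover have "b * w + a * z = 0"
    using * by (simp add: w_def z_def a_def b_def algebra_simps)
  ultimately have "z + b * (w / a) = 0"
    by (simp add: add_divide_eq_iff mult.commute add.commute)
  with True show ?thesis
    by (simp add: var_potential_def w_def z_def a_def b_def)
qed

text \<open>If both squares vanish, the odds \<open>p i False / p i True\<close> are the same in
  both rows, so the rows and their entropies coincide. Then \<open>c = 0\<close>, the odds are 1 and
  all entries are \<open>1 / 2\<close>.\<close>

lemma sigma2_pos:
  assumes "\<exists>i j. p i j \<noteq> 1 / 2"
  shows "0 < sigma2 p"
proof -
  note H = entropy_rate_pos
  define c where "c = (entropy_row p True - entropy_row p False) / (p False True + p True False)"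
  define x y where "x = ln (p False False / p False True) + c" and "y = ln (p True False / p True True) + c"
  have pos: "0 < stat0 p * p False False * p False True / H ^ 3" "0 < stat1 p * p True False * p True True / H ^ 3"
    by (intro divide_pos_pos mult_pos_pos zero_less_power stat_pos p_pos H)+
  have eq: "sigma2 p = stat0 p * p False False * p False True / H ^ 3 * x\<^sup>2
      + stat1 p * p True False * p True True / H ^ 3 * y\<^sup>2"
    unfolding sigma2_def Let_def c_def[symmetric] x_def[symmetric] y_def[symmetric] ..
  have "x \<noteq> 0 \<or> y \<noteq> 0"
  proof (rule ccontr)
    assume "\<not> ?thesis"
    then have "x = 0" "y = 0" by simp_all
    then have z: "ln (p False False / p False True) = - c" "ln (p True False / p True True) = - c"
      unfolding x_def y_def by linarith+
    then have "p False False / p False True = p True False / p True True"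
      by (metis divide_pos_pos ln_inj_iff p_pos)
    then have "p False False * p True True = p True False * p False True"
      using p_pos[of False True] p_pos[of True True] by (simp add: frac_eq_eq)
    then have eq: "p False False = p True False"
      unfolding p_True by (simp add: right_diff_distrib mult.commute)
    then have "c = 0" by (simp add: c_def entropy_row_eq p_True)
    then have "p False False / p False True = 1"
      using z(1) p_pos[of False False] p_pos[of False True] by (simp add: ln_eq_zero_iff)
    then have "p False False = p False True"
      using p_pos[of False True] by simp
    then have half: "p False False = 1 / 2"
      using p_sum[of False] by linarith
    have "p i j = 1 / 2" for i j
    proof -
      have "p i False = 1 / 2" using half eq by (cases i) simp_all
      then show ?thesis using p_sum[of i] by (cases j) auto
    qed
    with assms show False by simp
  qed
  then show ?thesis
  proof
    assume "x \<noteq> 0"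
    then show ?thesis
      unfolding eq by (intro add_pos_nonneg mult_pos_pos[OF pos(1)] mult_nonneg_nonneg less_imp_le[OF pos(2)]) simp_all
  next
    assume "y \<noteq> 0"
    then show ?thesis
      unfolding eq by (intro add_nonneg_pos mult_pos_pos[OF pos(2)] mult_nonneg_nonneg less_imp_le[OF pos(1)]) simp_all
  qed
qed

section \<open>Threshold crossing along the chain and the stopped martingale\<close>

primrec chain :: "nat \<Rightarrow> bool \<Rightarrow> bool list pmf" where
  "chain 0 i = return_pmf []"
| "chain (Suc L) i = bernoulli_pmf (p i True) \<bind> (\<lambda>j. map_pmf ((#) j) (chain L j))"

lemma finite_set_chain [simp]: "finite (set_pmf (chain L i))"
  by (induction L arbitrary: i) auto

lemma length_chain: "ys \<in> set_pmf (chain L i) \<Longrightarrow> length ys = L"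
  by (induction L arbitrary: i ys) auto

lemma integrable_chain [simp]: "integrable (measure_pmf (chain L i)) (f :: _ \<Rightarrow> real)"
  by (rule integrable_measure_pmf_finite) simp

lemma expectation_chain_Suc:
  fixes f :: "bool list \<Rightarrow> real"
  shows "measure_pmf.expectation (chain (Suc L) i) f
    = p i False * measure_pmf.expectation (chain L False) (\<lambda>ys. f (False # ys))
      + p i True * measure_pmf.expectation (chain L True) (\<lambda>ys. f (True # ys))"
  using p_pos[of i True] p_less_1[of i True] p_sum[of i]
  by (simp add: expectation_bind_finite)

text \<open>\<open>c\<close> is \<open>n\<close> times the weight of what has been read and
  \<open>i\<close> the last symbol read; keeping both as arguments turns the estimates into
  inductions with \<open>c\<close> and \<open>i\<close> arbitrary. The test precedes the next
  symbol, so a list of length \<open>L\<close> accounts for the levels \<open>k < L\<close>.\<close>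

primrec tau :: "real \<Rightarrow> bool \<Rightarrow> bool list \<Rightarrow> real" where
  "tau c i [] = 0"
| "tau c i (j # ys) = (if c < 1 then 0 else 1 + tau (c * p i j) j ys)"

primrec mart :: "real \<Rightarrow> bool \<Rightarrow> bool list \<Rightarrow> real" where
  "mart c i [] = 0"
| "mart c i (j # ys) = (if c < 1 then 0 else incr i j + mart (c * p i j) j ys)"

text \<open>A transition is made only from \<open>c >= 1\<close>, so the threshold never falls below
  \<open>p_min\<close>: the overshoot at the stopping time is bounded.\<close>

lemma threshold_step:
  assumes "1 \<le> c"
  shows "p_min \<le> c * p i j"
  using assms p_min_le[of i j] p_pos[of i j] mult_right_mono[of 1 c "p i j"] by linarith

text \<open>The condition \<open>c * p_max ^ n < 1\<close> guarantees that \<open>n\<close> further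
  symbols cross the threshold, whatever they are; it survives a step with one symbol less.\<close>

lemma threshold_length:
  assumes "c * p_max ^ Suc n < 1" "0 \<le> c"
  shows "c * p i j * p_max ^ n < 1"
proof -
  have "c * p i j * p_max ^ n \<le> c * p_max * p_max ^ n"
    using assms p_max_ge[of i j] p_max_pos by (intro mult_right_mono mult_left_mono) auto
  with assms show ?thesis by simp
qed

lemma tau_append:
  assumes "c * p_max ^ length ys < 1" "0 \<le> c"
  shows "tau c i (ys @ zs) = tau c i ys"
  using assms
proof (induction ys arbitrary: c i)
  case Nil
  then show ?case by (cases zs) auto
next
  case (Cons j ys)
  then show ?case
    using threshold_length[of c "length ys" i j] p_pos[of i j] Cons.IH[of "c * p i j" j] by simp
qed

lemma tau_nonneg: "0 \<le> tau c i ys"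
  by (induction ys arbitrary: c i) auto

text \<open>Each counted level lowers \<open>ln c\<close> by at least \<open>- ln p_max\<close>, and
  levels are counted only while \<open>ln c\<close> is nonnegative. The \<open>max\<close> covers
  \<open>c < 1\<close>, where nothing is counted.\<close>

lemma tau_le:
  assumes "0 < c"
  shows "tau c i ys * (- ln p_max) \<le> max 0 (- ln p_max + ln c)"
  using assms
proof (induction ys arbitrary: c i)
  case Nil
  then show ?case by simp
next
  case (Cons j ys)
  show ?case
  proof (cases "c < 1")
    case False
    define \<delta> t where "\<delta> = - ln p_max" and "t = tau (c * p i j) j ys"
    have step: "ln (c * p i j) = ln c + ln (p i j)"
      using Cons.prems p_pos[of i j] by (simp add: ln_mult)
    have "ln (p i j) \<le> - \<delta>"
      unfolding \<delta>_def using p_pos[of i j] p_max_ge[of i j] by simp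
    moreover have "t * \<delta> \<le> max 0 (\<delta> + (ln c + ln (p i j)))"
      unfolding \<delta>_def t_def step[symmetric] using Cons.prems p_pos[of i j] by (intro Cons.IH mult_pos_pos)
    moreover have "0 \<le> ln c" using False by simp
    ultimately have "t * \<delta> \<le> ln c"
      unfolding le_max_iff_disj by linarith
    then have "(1 + t) * \<delta> \<le> max 0 (\<delta> + ln c)"
      by (simp add: distrib_right le_max_iff_disj)
    moreover have "tau c i (j # ys) = 1 + t"
      using False by (simp add: t_def)
    ultimately show ?thesis unfolding \<delta>_def by (simp only:)
  qed simp
qed

lemma ln_p_min_le:
  assumes "p_min \<le> c" "c < 1"
  shows "\<bar>ln c\<bar> \<le> \<bar>ln p_min\<bar>"
proof -
  have "0 < c" using assms(1) p_min_pos by linarith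
  then have "ln p_min \<le> ln c" "ln c < 0" using assms p_min_pos by simp_all
  then show ?thesis by linarith
qed

text \<open>The expression between the bars is invariant under a transition. At the stopping time
  only \<open>ln c / H\<close> and a potential are left, and both are bounded there because
  \<open>c\<close> lies between \<open>p_min\<close> and 1.\<close>

lemma tau_mart:
  assumes "p_min \<le> c" "c * p_max ^ length ys < 1"
  shows "\<bar>tau c i ys - ln c / H - potential i - mart c i ys\<bar>
    \<le> \<bar>ln p_min\<bar> / H + \<bar>potential False\<bar>"
proof -
  note H = entropy_rate_pos
  have base: "\<bar>0 - ln c / H - potential i - 0\<bar> \<le> \<bar>ln p_min\<bar> / H + \<bar>potential False\<bar>"
    if "p_min \<le> c" "c < 1" for c i
  proof -
    have "\<bar>ln c\<bar> \<le> \<bar>ln p_min\<bar>"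
      using ln_p_min_le[OF that] .
    then have "\<bar>ln c / H\<bar> \<le> \<bar>ln p_min\<bar> / H" using H by (simp add: divide_right_mono)
    moreover have "\<bar>potential i\<bar> \<le> \<bar>potential False\<bar>" by (simp add: potential_def)
    ultimately show ?thesis by linarith
  qed
  show ?thesis using assms
  proof (induction ys arbitrary: c i)
    case Nil
    then show ?case using base[of c i] by simp
  next
    case (Cons j ys)
    show ?case
    proof (cases "c < 1")
      case True
      then show ?thesis using base[of c i] Cons.prems by simp
    next
      case False
      have c: "0 < c" using Cons.prems p_min_pos by linarith
      have "ln (c * p i j) = ln c + ln (p i j)"
        using c p_pos[of i j] by (simp add: ln_mult)
      then have "tau c i (j # ys) - ln c / H - potential i - mart c i (j # ys)
        = tau (c * p i j) j ys - ln (c * p i j) / H - potential j - mart (c * p i j) j ys"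
        using False by (simp add: incr_def add_divide_distrib)
      moreover have "\<bar>tau (c * p i j) j ys - ln (c * p i j) / H - potential j - mart (c * p i j) j ys\<bar>
        \<le> \<bar>ln p_min\<bar> / H + \<bar>potential False\<bar>"
        using Cons.prems False threshold_step[of c i j] threshold_length[of c "length ys" i j] c
        by (intro Cons.IH) auto
      ultimately show ?thesis by simp
    qed
  qed
qed

lemma expectation_mart: "measure_pmf.expectation (chain L i) (mart c i) = 0"
proof (induction L arbitrary: c i)
  case (Suc L)
  show ?case
    unfolding expectation_chain_Suc using Suc incr_mean[of i]
    by (cases "c < 1") simp_all
qed simp

text \<open>Along a transition the conditional variance, the decrease of
  \<open>sigma2 p * ln c\<close> and the change of \<open>var_potential\<close> cancel by
  \<open>var_potential_eq\<close>. The error is therefore an average of errors at the stopping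
  time.\<close>

lemma expectation_mart_square:
  assumes "p_min \<le> c" "c * p_max ^ L < 1"
  shows "\<bar>measure_pmf.expectation (chain L i) (\<lambda>ys. (mart c i ys)\<^sup>2) - sigma2 p * ln c - var_potential i\<bar>
    \<le> \<bar>sigma2 p * ln p_min\<bar> + \<bar>var_potential False\<bar>"
proof -
  have base: "\<bar>0 - sigma2 p * ln c - var_potential i\<bar> \<le> \<bar>sigma2 p * ln p_min\<bar> + \<bar>var_potential False\<bar>"
    if "p_min \<le> c" "c < 1" for c i
  proof -
    have "\<bar>ln c\<bar> \<le> \<bar>ln p_min\<bar>"
      using ln_p_min_le[OF that] .
    then have "\<bar>sigma2 p * ln c\<bar> \<le> \<bar>sigma2 p * ln p_min\<bar>" by (simp add: abs_mult mult_left_mono)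
    moreover have "\<bar>var_potential i\<bar> \<le> \<bar>var_potential False\<bar>" by (simp add: var_potential_def)
    ultimately show ?thesis by linarith
  qed
  show ?thesis using assms
  proof (induction L arbitrary: c i)
    case 0
    then show ?case using base[of c i] by simp
  next
    case (Suc L)
    show ?case
    proof (cases "c < 1")
      case True
      then have "mart c i ys = 0" for ys by (cases ys) auto
      then show ?thesis using base[of c i] Suc.prems True by simp
    next
      case False
      have c: "0 < c" using Suc.prems p_min_pos by linarith
      \<comment> \<open>The same error after the symbol \<open>j\<close> has been read.\<close>
      define u where "u j = measure_pmf.expectation (chain L j) (\<lambda>ys. (mart (c * p i j) j ys)\<^sup>2)
        - sigma2 p * ln (c * p i j) - var_potential j" for j
      have u: "\<bar>u j\<bar> \<le> \<bar>sigma2 p * ln p_min\<bar> + \<bar>var_potential False\<bar>" for j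
        unfolding u_def using Suc.prems False threshold_step[of c i j] threshold_length[of c L i j] c
        by (intro Suc.IH) auto
      \<comment> \<open>Orthogonality of increments: the cross term contains the mean of the later
        martingale, which is zero.\<close>
      have sq: "measure_pmf.expectation (chain L j) (\<lambda>ys. (mart c i (j # ys))\<^sup>2)
        = (incr i j)\<^sup>2 + u j + sigma2 p * ln (c * p i j) + var_potential j" for j
        using False expectation_mart[of L j "c * p i j"] by (simp add: power2_sum u_def)
      have ln: "ln (c * p i j) = ln c + ln (p i j)" for j
        using c p_pos[of i j] by (simp add: ln_mult)
      have lc: "sigma2 p * ln c = p i False * (sigma2 p * ln c) + p i True * (sigma2 p * ln c)"
        using p_sum[of i] by (simp flip: distrib_right)
      have "measure_pmf.expectation (chain (Suc L) i) (\<lambda>ys. (mart c i ys)\<^sup>2) - sigma2 p * ln c - var_potential i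
        = p i False * u False + p i True * u True
        + (incr_var i - sigma2 p * entropy_row p i + (p i False * var_potential False + p i True * var_potential True) - var_potential i)"
        unfolding expectation_chain_Suc sq ln incr_var_def entropy_row_eq using lc by algebra
      also have "\<dots> = p i False * u False + p i True * u True"
        unfolding var_potential_eq by simp
      finally have *: "measure_pmf.expectation (chain (Suc L) i) (\<lambda>ys. (mart c i ys)\<^sup>2) - sigma2 p * ln c - var_potential i
        = p i False * u False + p i True * u True" .
      have "\<bar>p i False * u False + p i True * u True\<bar> \<le> p i False * \<bar>u False\<bar> + p i True * \<bar>u True\<bar>"
        using p_pos[of i False] p_pos[of i True]
        by (intro abs_triangle_ineq[THEN order_trans]) (simp add: abs_mult)
      also have "\<dots> \<le> p i False * (\<bar>sigma2 p * ln p_min\<bar> + \<bar>var_potential False\<bar>)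
        + p i True * (\<bar>sigma2 p * ln p_min\<bar> + \<bar>var_potential False\<bar>)"
        using u p_pos[of i] by (intro add_mono mult_left_mono) (auto simp: less_imp_le)
      also have "\<dots> = \<bar>sigma2 p * ln p_min\<bar> + \<bar>var_potential False\<bar>"
        using p_sum[of i] by (simp flip: distrib_right)
      finally show ?thesis unfolding * .
    qed
  qed
qed

end

section \<open>Levels at which prefixes are shared\<close>

text \<open>The summands decay geometrically on both sides of the place where \<open>s\<close>
  passes 1, so the sum is bounded independently of \<open>L\<close> and of
  \<open>s 0\<close>.\<close>

lemma sum_min_geometric:
  fixes s :: "nat \<Rightarrow> real"
  assumes s: "\<And>k. 0 < s k" "\<And>k. s (Suc k) \<le> r * s k" and r: "0 < r" "r < 1"
  shows "(\<Sum>k<L. min (s k) (1 / s k)) \<le> 2 / (1 - r)"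
proof -
  \<comment> \<open>Before the crossing the sum is a geometric series dominated by its last term
    \<open>1 / s n\<close>. After it, the new terms times \<open>1 - r\<close> telescope, and
    \<open>- r * s n\<close> is the credit that pays for the next one.\<close>
  have *: "(\<Sum>k\<le>n. min (s k) (1 / s k)) * (1 - r) \<le> (if 1 \<le> s n then 1 / s n else 2 - r * s n)" for n
  proof (induction n)
    case 0
    have "min (s 0) (1 / s 0) * (1 - r) \<le> min (s 0) (1 / s 0) * 1"
      using r s(1)[of 0] by (intro mult_left_mono) auto
    moreover have "r * s 0 \<le> 1 * s 0"
      using r s(1)[of 0] by (intro mult_right_mono) auto
    ultimately show ?case by auto
  next
    case (Suc n)
    let ?S = "\<Sum>k\<le>n. min (s k) (1 / s k)"
    have le: "s (Suc n) \<le> r * s n" and pos: "0 < s (Suc n)" "0 < s n"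
      using s by auto
    have "r * s n \<le> 1 * s n" using r pos by (intro mult_right_mono) auto
    with le have le': "s (Suc n) \<le> s n" by simp
    show ?case
    proof (cases "1 \<le> s (Suc n)")
      case True
      then have "1 \<le> s n" using le' by simp
      with Suc have "?S * (1 - r) \<le> 1 / s n" by simp
      also have "\<dots> \<le> r * (1 / s (Suc n))"
        using le pos r by (simp add: field_simps)
      finally have "?S * (1 - r) \<le> r * (1 / s (Suc n))" .
      moreover have "1 / s (Suc n) * (1 - r) = 1 / s (Suc n) - r * (1 / s (Suc n))"
        by (simp add: right_diff_distrib)
      moreover have "1 * 1 \<le> s (Suc n) * s (Suc n)"
        using True by (intro mult_mono) auto
      then have "min (s (Suc n)) (1 / s (Suc n)) = 1 / s (Suc n)"
        using pos by (intro min_absorb2) (simp add: divide_le_eq)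
      then have "(\<Sum>k\<le>Suc n. min (s k) (1 / s k)) * (1 - r) = ?S * (1 - r) + 1 / s (Suc n) * (1 - r)"
        by (simp only: sum.atMost_Suc distrib_right)
      ultimately show ?thesis using True by (simp only: if_True)
    next
      case False
      then have m: "min (s (Suc n)) (1 / s (Suc n)) = s (Suc n)"
        using pos by (intro min_absorb1) (simp add: le_divide_eq mult_le_one)
      have "?S * (1 - r) \<le> 2 - s (Suc n)"
      proof (cases "1 \<le> s n")
        case True
        with Suc have "?S * (1 - r) \<le> 1 / s n" by simp
        also have "\<dots> \<le> 1" using True by simp
        finally show ?thesis using False by simp
      next
        case False
        with Suc le show ?thesis by simp
      qed
      moreover have "(\<Sum>k\<le>Suc n. min (s k) (1 / s k)) * (1 - r) = ?S * (1 - r) + s (Suc n) * (1 - r)"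
        using m by (simp only: sum.atMost_Suc distrib_right)
      moreover have "s (Suc n) * (1 - r) = s (Suc n) - r * s (Suc n)"
        by (simp add: right_diff_distrib)
      ultimately show ?thesis using False by (simp only: if_False)
    qed
  qed
  show ?thesis
  proof (cases L)
    case 0
    then show ?thesis using r by simp
  next
    case (Suc n)
    have "(if 1 \<le> s n then 1 / s n else 2 - r * s n) \<le> 2"
      using r s(1)[of n] by (auto simp: divide_le_eq)
    with *[of n] have "(\<Sum>k<L. min (s k) (1 / s k)) * (1 - r) \<le> 2"
      unfolding Suc lessThan_Suc_atMost by linarith
    then show ?thesis using r by (simp add: le_divide_eq)
  qed
qed

text \<open>Works for dependent levels: as \<open>b\<close> lies between 0 and \<open>c\<close>, a
  mixed moment is at most \<open>c\<close> times either of the two first moments, and the smaller of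
  the squares of \<open>t k\<close> and \<open>t l\<close> is at most \<open>t k * t l\<close>. The
  double sum then factors.\<close>

lemma expectation_square_sum_le:
  fixes b :: "nat \<Rightarrow> 'a \<Rightarrow> real"
  assumes fin: "finite (set_pmf P)"
    and b: "\<And>k x. x \<in> set_pmf P \<Longrightarrow> 0 \<le> b k x" "\<And>k x. x \<in> set_pmf P \<Longrightarrow> b k x \<le> c"
    and t: "\<And>k. 0 \<le> t k" "\<And>k. k < L \<Longrightarrow> measure_pmf.expectation P (b k) \<le> K * (t k)\<^sup>2"
    and c: "0 \<le> c" "0 \<le> K"
  shows "measure_pmf.expectation P (\<lambda>x. (\<Sum>k<L. b k x)\<^sup>2) \<le> c * K * (\<Sum>k<L. t k)\<^sup>2"
proof -
  note [simp] = integrable_measure_pmf_finite[OF fin]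
  have pair: "measure_pmf.expectation P (\<lambda>x. b k x * b l x) \<le> c * (K * (t k)\<^sup>2)" if "k < L" for k l
  proof -
    have "measure_pmf.expectation P (\<lambda>x. b k x * b l x) \<le> measure_pmf.expectation P (\<lambda>x. c * b k x)"
      using b c by (intro expectation_pmf_mono fin) (subst mult.commute, intro mult_right_mono, auto)
    also have "\<dots> \<le> c * (K * (t k)\<^sup>2)"
      using t(2)[OF that] c by (simp add: mult_left_mono)
    finally show ?thesis .
  qed
  have prod: "measure_pmf.expectation P (\<lambda>x. b k x * b l x) \<le> c * K * (t k * t l)" if "k < L" "l < L" for k l
  proof (cases "t k \<le> t l")
    case True
    then have "(t k)\<^sup>2 \<le> t k * t l" using t(1)[of k] by (simp add: power2_eq_square mult_left_mono)
    then have "c * K * (t k)\<^sup>2 \<le> c * K * (t k * t l)" using c by (intro mult_left_mono) auto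
    with pair[OF that(1), of l] show ?thesis by simp
  next
    case False
    then have "(t l)\<^sup>2 \<le> t k * t l" using t(1)[of l] by (simp add: power2_eq_square mult_right_mono)
    then have "c * K * (t l)\<^sup>2 \<le> c * K * (t k * t l)" using c by (intro mult_left_mono) auto
    with pair[OF that(2), of k] show ?thesis by (simp add: mult.commute[of "b k _"])
  qed
  have "measure_pmf.expectation P (\<lambda>x. (\<Sum>k<L. b k x)\<^sup>2)
    = (\<Sum>k<L. \<Sum>l<L. measure_pmf.expectation P (\<lambda>x. b k x * b l x))"
    by (simp add: power2_eq_square sum_product)
  also have "\<dots> \<le> (\<Sum>k<L. \<Sum>l<L. c * K * (t k * t l))"
    by (intro sum_mono prod) auto
  also have "\<dots> = c * K * (\<Sum>k<L. t k)\<^sup>2"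
    by (simp only: power2_eq_square sum_product) (simp only: sum_distrib_left)
  finally show ?thesis .
qed

text \<open>The strings are represented by prefixes; \<open>agree k y z\<close> compares positions \<open>0\<close> to \<open>k\<close>
  inclusive.\<close>

definition agree :: "nat \<Rightarrow> bool list \<Rightarrow> bool list \<Rightarrow> bool" where
  "agree k y z \<longleftrightarrow> take (Suc k) y = take (Suc k) z"

definition level_count :: "nat set \<Rightarrow> (nat \<Rightarrow> bool list) \<Rightarrow> bool list \<Rightarrow> nat \<Rightarrow> nat" where
  "level_count A x z k = card {l \<in> A. agree k (x l) z}"

definition depth :: "nat \<Rightarrow> nat set \<Rightarrow> (nat \<Rightarrow> bool list) \<Rightarrow> nat \<Rightarrow> real" where
  "depth L A x j = (\<Sum>k<L. of_bool (\<exists>l\<in>A - {j}. agree k (x l) (x j)))"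

lemma level_count_eq_sum:
  assumes "finite A"
  shows "real (level_count A x z k) = (\<Sum>l\<in>A. of_bool (agree k (x l) z))"
  using assms by (simp add: level_count_def sum.If_cases of_bool_def Int_def)

lemma level_count_ge_1: "finite A \<Longrightarrow> 1 \<le> level_count A x z k \<longleftrightarrow> (\<exists>l\<in>A. agree k (x l) z)"
  by (auto simp: level_count_def Suc_le_eq card_gt_0_iff)

lemma sum_of_bool_eq_singleton:
  assumes "finite B" "C \<subseteq> B"
  shows "(\<Sum>l\<in>B. of_bool (C = {l})) = (of_bool (card C = 1) :: real)"
proof (cases "card C = 1")
  case True
  then obtain c where c: "C = {c}" by (auto simp: card_1_singleton_iff)
  with assms have "c \<in> B" by simp
  then show ?thesis
    using assms by (simp add: c of_bool_def)
next
  case False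
  then have "C \<noteq> {l}" for l by auto
  with False show ?thesis by simp
qed

text \<open>Removing the string \<open>j\<close> only changes the contribution of another string at level \<open>k\<close>
  if \<open>j\<close> is the unique string sharing its prefix.\<close>

lemma depth_remove:
  assumes A: "finite A" "j \<in> A"
  shows "(\<Sum>l\<in>A. depth L A x l) - (\<Sum>l\<in>A - {j}. depth L (A - {j}) x l)
    = (\<Sum>k<L. of_bool (1 \<le> level_count (A - {j}) x (x j) k) + of_bool (level_count (A - {j}) x (x j) k = 1))"
proof -
  let ?B = "A - {j}"
  have level: "(\<Sum>l\<in>?B. of_bool (\<exists>m\<in>A - {l}. agree k (x m) (x l)) - of_bool (\<exists>m\<in>?B - {l}. agree k (x m) (x l)))
    = (of_bool (level_count ?B x (x j) k = 1) :: real)" for k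
  proof -
    let ?C = "{l \<in> ?B. agree k (x l) (x j)}"
    have "(of_bool (\<exists>m\<in>A - {l}. agree k (x m) (x l)) - of_bool (\<exists>m\<in>?B - {l}. agree k (x m) (x l)) :: real)
      = of_bool (?C = {l})" if "l \<in> ?B" for l
    proof -
      \<comment> \<open>\<open>agree k\<close> is an equivalence relation: if \<open>l\<close>
        agrees with \<open>j\<close>, both have the same partners, so \<open>l\<close> has no
        further partner in \<open>?B\<close> exactly if \<open>l\<close> is the only partner of
        \<open>j\<close>.\<close>
      have "?C = {l} \<longleftrightarrow> agree k (x j) (x l) \<and> \<not> (\<exists>m\<in>?B - {l}. agree k (x m) (x l))" (is "?L \<longleftrightarrow> ?R")
      proof
        assume ?L
        then have l: "agree k (x l) (x j)" and only: "\<And>m. m \<in> ?B \<Longrightarrow> agree k (x m) (x j) \<Longrightarrow> m = l"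
          by blast+
        from l have "agree k (x m) (x l) \<longleftrightarrow> agree k (x m) (x j)" for m
          by (simp add: agree_def)
        with l only show ?R by (auto simp: agree_def)
      next
        assume ?R
        then have l: "agree k (x l) (x j)" by (simp add: agree_def)
        then have "agree k (x m) (x l) \<longleftrightarrow> agree k (x m) (x j)" for m
          by (simp add: agree_def)
        with l \<open>?R\<close> that show ?L by blast
      qed
      moreover have "(\<exists>m\<in>A - {l}. agree k (x m) (x l)) \<longleftrightarrow> agree k (x j) (x l) \<or> (\<exists>m\<in>?B - {l}. agree k (x m) (x l))"
        using that A by auto
      ultimately show ?thesis by auto
    qed
    then have "(\<Sum>l\<in>?B. of_bool (\<exists>m\<in>A - {l}. agree k (x m) (x l)) - of_bool (\<exists>m\<in>?B - {l}. agree k (x m) (x l)))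
      = (\<Sum>l\<in>?B. of_bool (?C = {l}) :: real)"
      by (rule sum.cong[OF refl])
    also have "\<dots> = of_bool (card ?C = 1)"
      using A by (intro sum_of_bool_eq_singleton) auto
    finally show ?thesis unfolding level_count_def .
  qed
  have "(\<Sum>l\<in>A. depth L A x l) = depth L A x j + (\<Sum>l\<in>?B. depth L A x l)"
    using A by (simp add: sum.remove)
  moreover have "(\<Sum>l\<in>?B. depth L A x l) - (\<Sum>l\<in>?B. depth L ?B x l)
    = (\<Sum>k<L. of_bool (level_count ?B x (x j) k = 1))"
    unfolding depth_def sum_subtractf[symmetric] by (subst sum.swap) (simp only: level)
  moreover have "depth L A x j = (\<Sum>k<L. of_bool (1 \<le> level_count ?B x (x j) k))"
    unfolding depth_def using A by (intro sum.cong refl arg_cong[where f = of_bool]) (simp only: level_count_ge_1[OF finite_Diff[OF A(1)]])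
  ultimately show ?thesis by (simp add: sum.distrib)
qed

section \<open>The remainder on truncated strings\<close>

locale markov_source = transition_matrix +
  fixes \<mu> :: "bool \<Rightarrow> real"
  assumes \<mu>_nonneg: "0 \<le> \<mu> i" and \<mu>_sum: "\<mu> False + \<mu> True = 1"
begin

section \<open>Prefix probabilities of the truncated source\<close>

definition source :: "nat \<Rightarrow> bool list pmf" where
  "source L = bernoulli_pmf (\<mu> True) \<bind> (\<lambda>i. map_pmf ((#) i) (chain L i))"

text \<open>Conditional probability of the first \<open>k + 1\<close> symbols given the first one.
  Leaving out the initial probability makes the threshold test the same for every
  \<open>\<mu>\<close>.\<close>

definition prefix_weight :: "bool list \<Rightarrow> nat \<Rightarrow> real" where
  "prefix_weight z k = (\<Prod>i<k. p (z ! i) (z ! Suc i))"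

definition level_tau :: "real \<Rightarrow> bool list \<Rightarrow> real" where
  "level_tau c z = tau c (hd z) (tl z)"

text \<open>The least positive initial probability. Symbols of probability zero never start a
  string, so this bound remains usable when \<open>\<mu>\<close> is a point mass.\<close>

definition \<mu>_min :: real where
  "\<mu>_min = (if \<mu> False = 0 then \<mu> True else if \<mu> True = 0 then \<mu> False else min (\<mu> False) (\<mu> True))"

lemma \<mu>_le_1: "\<mu> i \<le> 1"
  using \<mu>_nonneg[of False] \<mu>_nonneg[of True] \<mu>_sum by (cases i) auto

lemma \<mu>_min_pos: "0 < \<mu>_min" and \<mu>_min_le_1: "\<mu>_min \<le> 1"
  using \<mu>_nonneg[of False] \<mu>_nonneg[of True] \<mu>_sum by (auto simp: \<mu>_min_def)

lemma \<mu>_min_le: "0 < \<mu> i \<Longrightarrow> \<mu>_min \<le> \<mu> i"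
  by (cases i) (auto simp: \<mu>_min_def)

lemma finite_set_source [simp]: "finite (set_pmf (source L))"
  by (simp add: source_def)

lemma integrable_source [simp]: "integrable (measure_pmf (source L)) (f :: _ \<Rightarrow> real)"
  by (rule integrable_measure_pmf_finite) simp

lemma set_pmf_source:
  assumes "z \<in> set_pmf (source L)"
  shows "length z = Suc L" "0 < \<mu> (z ! 0)"
proof -
  obtain i ys where z: "z = i # ys" and i: "i \<in> set_pmf (bernoulli_pmf (\<mu> True))" and ys: "ys \<in> set_pmf (chain L i)"
    using assms by (auto simp: source_def)
  show "length z = Suc L" using length_chain[OF ys] z by simp
  have "0 < pmf (bernoulli_pmf (\<mu> True)) i"
    using i by (rule pmf_positive)
  also have "pmf (bernoulli_pmf (\<mu> True)) i = \<mu> i"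
    using \<mu>_sum \<mu>_nonneg[of True] \<mu>_le_1[of True] by (cases i) auto
  finally show "0 < \<mu> (z ! 0)" using z by simp
qed

lemma expectation_source:
  fixes f :: "bool list \<Rightarrow> real"
  shows "measure_pmf.expectation (source L) f
    = \<mu> False * measure_pmf.expectation (chain L False) (\<lambda>ys. f (False # ys))
      + \<mu> True * measure_pmf.expectation (chain L True) (\<lambda>ys. f (True # ys))"
proof -
  have "\<mu> False = 1 - \<mu> True" using \<mu>_sum by simp
  then show ?thesis
    using \<mu>_nonneg[of True] \<mu>_le_1[of True] by (simp add: source_def expectation_bind_finite)
qed

lemma prefix_weight_0 [simp]: "prefix_weight z 0 = 1"
  by (simp add: prefix_weight_def)

lemma prefix_weight_Cons: "prefix_weight (i # j # ys) (Suc k) = p i j * prefix_weight (j # ys) k"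
  unfolding prefix_weight_def prod.lessThan_Suc_shift by simp

lemma prefix_weight_pos: "0 < prefix_weight z k"
  unfolding prefix_weight_def by (intro prod_pos) (simp add: p_pos)

lemma prefix_weight_Suc_le: "prefix_weight z (Suc k) \<le> p_max * prefix_weight z k"
proof -
  have "prefix_weight z (Suc k) = p (z ! k) (z ! Suc k) * prefix_weight z k"
    by (simp add: prefix_weight_def)
  then show ?thesis
    using p_max_ge prefix_weight_pos[of z k] by (simp add: mult_right_mono less_imp_le)
qed

lemma prefix_weight_le_1: "prefix_weight z k \<le> 1"
  unfolding prefix_weight_def
  by (intro prod_le_1) (use p_pos p_less_1 in \<open>auto intro: less_imp_le\<close>)

text \<open>Prefix weights never increase with \<open>k\<close>, so the first failed test is final
  and stopping loses no level. In this form \<open>tau\<close> can be compared with the depth level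
  by level.\<close>

lemma tau_eq_sum:
  assumes "0 \<le> c"
  shows "tau c i ys = (\<Sum>k<length ys. of_bool (1 \<le> c * prefix_weight (i # ys) k))"
  using assms
proof (induction ys arbitrary: c i)
  case (Cons j ys)
  show ?case
  proof (cases "c < 1")
    case True
    have "c * prefix_weight (i # j # ys) k < 1" for k
      using mult_left_mono[OF prefix_weight_le_1[of "i # j # ys" k] Cons.prems] True by simp
    then have "\<not> 1 \<le> c * prefix_weight (i # j # ys) k" for k
      by (simp add: not_le)
    then show ?thesis using True by simp
  next
    case False
    have "tau (c * p i j) j ys = (\<Sum>k<length ys. of_bool (1 \<le> c * p i j * prefix_weight (j # ys) k))"
      using Cons.prems p_pos[of i j] by (intro Cons.IH) simp
    then show ?thesis
      using False by (simp add: sum.lessThan_Suc_shift prefix_weight_Cons mult.assoc del: sum.lessThan_Suc)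
  qed
qed simp

lemma chain_prefix_prob:
  assumes "k \<le> L" "k \<le> length zs"
  shows "measure_pmf.expectation (chain L i) (\<lambda>ys. of_bool (take k ys = take k zs)) = prefix_weight (i # zs) k"
  using assms
proof (induction k arbitrary: L i zs)
  case (Suc k)
  obtain L' where L: "L = Suc L'" using Suc.prems by (cases L) auto
  obtain j zs' where zs: "zs = j # zs'" using Suc.prems by (cases zs) auto
  have IH: "measure_pmf.expectation (chain L' j) (\<lambda>ys. of_bool (take k ys = take k zs')) = prefix_weight (j # zs') k"
    using Suc.prems by (intro Suc.IH) (auto simp: L zs)
  show ?case
    unfolding L expectation_chain_Suc zs prefix_weight_Cons using IH by (cases j) simp_all
qed simp

lemma agree_prob:
  assumes "k < Suc L" "length z = Suc L"
  shows "measure_pmf.expectation (source L) (\<lambda>y. of_bool (agree k y z)) = \<mu> (z ! 0) * prefix_weight z k"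
proof -
  obtain i zs where z: "z = i # zs" using assms by (cases z) auto
  have "measure_pmf.expectation (chain L i) (\<lambda>ys. of_bool (take k ys = take k zs)) = prefix_weight z k"
    using assms unfolding z by (intro chain_prefix_prob) auto
  then show ?thesis
    unfolding expectation_source by (cases i) (simp_all add: z agree_def)
qed

lemma pmf_source:
  assumes "length z = Suc L"
  shows "pmf (source L) z = \<mu> (z ! 0) * prefix_weight z L"
proof -
  have "pmf (source L) z = measure_pmf.expectation (source L) (\<lambda>y. of_bool (y = z))"
    by (subst integral_measure_pmf_real[of "{z}"]) auto
  also have "\<dots> = measure_pmf.expectation (source L) (\<lambda>y. of_bool (agree L y z))"
    using assms by (intro integral_cong_AE) (auto simp: AE_measure_pmf_iff agree_def set_pmf_source(1))
  also have "\<dots> = \<mu> (z ! 0) * prefix_weight z L"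
    using assms by (intro agree_prob) auto
  finally show ?thesis .
qed

definition sources :: "nat \<Rightarrow> nat set \<Rightarrow> (nat \<Rightarrow> bool list) pmf" where
  "sources L A = Pi_pmf A [] (\<lambda>_. source L)"

lemma finite_set_sources [simp]: "finite A \<Longrightarrow> finite (set_pmf (sources L A))"
  unfolding sources_def by (rule finite_set_Pi_pmf) auto

lemma integrable_sources [simp]: "finite A \<Longrightarrow> integrable (measure_pmf (sources L A)) (f :: _ \<Rightarrow> real)"
  by (rule integrable_measure_pmf_finite) simp

lemma expectation_sources_component:
  fixes f :: "bool list \<Rightarrow> real"
  assumes "finite A" "l \<in> A"
  shows "measure_pmf.expectation (sources L A) (\<lambda>x. f (x l)) = measure_pmf.expectation (source L) f"
proof -
  have "source L = map_pmf (\<lambda>x. x l) (sources L A)"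
    unfolding sources_def using assms by (subst Pi_pmf_component) auto
  then show ?thesis by simp
qed

text \<open>A bound for the effect on the remainder of inserting a string with prefix \<open>z\<close> into the set \<open>A\<close>.\<close>

definition level_defect :: "nat \<Rightarrow> real \<Rightarrow> bool list \<Rightarrow> nat set \<Rightarrow> (nat \<Rightarrow> bool list) \<Rightarrow> real" where
  "level_defect L c z A x = (\<Sum>k<L. if 1 \<le> c * prefix_weight z k
      then of_bool (level_count A x z k \<le> 1) else 2 * of_bool (1 \<le> level_count A x z k))"

text \<open>As for a binomial count, the variance is at most the mean: leaving out string
  \<open>l\<close> in Efron--Stein, the squared difference is the indicator that \<open>l\<close>
  agrees with \<open>z\<close>.\<close>

lemma level_count_moments:
  fixes L k :: nat and A :: "nat set" and z :: "bool list"
  defines "m \<equiv> card A * (\<mu> (z ! 0) * prefix_weight z k)"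
  assumes A: "finite A" and z: "k < L" "length z = Suc L"
  shows "measure_pmf.expectation (sources L A) (\<lambda>x. real (level_count A x z k)) = m"
    and "measure_pmf.variance (sources L A) (\<lambda>x. real (level_count A x z k)) \<le> m"
proof -
  let ?E = "measure_pmf.expectation (sources L A)"
  have q: "?E (\<lambda>x. of_bool (agree k (x l) z)) = \<mu> (z ! 0) * prefix_weight z k" if "l \<in> A" for l
    using expectation_sources_component[OF A that, of L "\<lambda>y. of_bool (agree k y z)"] z
    by (simp add: agree_prob)
  show "?E (\<lambda>x. real (level_count A x z k)) = m"
    using A q by (simp add: level_count_eq_sum m_def del: sum_of_bool_eq)
  have "measure_pmf.variance (sources L A) (\<lambda>x. real (level_count A x z k))
    \<le> (\<Sum>l\<in>A. ?E (\<lambda>x. (real (level_count A x z k) - (\<Sum>l'\<in>A - {l}. of_bool (agree k (x l') z)))\<^sup>2))"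
    unfolding sources_def using A by (intro efron_stein) auto
  also have "\<dots> = (\<Sum>l\<in>A. ?E (\<lambda>x. of_bool (agree k (x l) z)))"
  proof (intro sum.cong refl Bochner_Integration.integral_cong)
    fix l x assume "l \<in> A"
    then show "(real (level_count A x z k) - (\<Sum>l'\<in>A - {l}. of_bool (agree k (x l') z)))\<^sup>2 = of_bool (agree k (x l) z)"
      using A by (simp add: level_count_eq_sum sum.remove[of A l] del: sum_of_bool_eq)
  qed
  also have "\<dots> = m" using q by (simp add: m_def)
  finally show "measure_pmf.variance (sources L A) (\<lambda>x. real (level_count A x z k)) \<le> m" .
qed

text \<open>\<open>2\<close> bounds the contribution of one level, \<open>12 / \<mu>_min\<close> is
  the constant in the bound of its mean, and the last factor comes from
  \<open>sum_min_geometric\<close> with ratio \<open>sqrt p_max\<close>.\<close>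

definition defect_const :: real where
  "defect_const = 2 * (12 / \<mu>_min) * (2 / (1 - sqrt p_max))\<^sup>2"

text \<open>Let \<open>a = n * prefix_weight z k\<close>. If \<open>a < 1\<close>, Markov's
  inequality bounds the probability of a nonempty level; if \<open>a >= 1\<close>, at most one
  string is a deviation controlled by Chebyshev. Both give a mean of at most
  \<open>K * min a (1 / a)\<close>. The square roots \<open>s k\<close> bring this into the form
  required by \<open>expectation_square_sum_le\<close>.\<close>

lemma expectation_level_defect:
  assumes A: "finite A" "2 \<le> n" "card A = n - 1" and z: "length z = Suc L" "0 < \<mu> (z ! 0)"
  shows "measure_pmf.expectation (sources L A) (\<lambda>x. (level_defect L n z A x)\<^sup>2) \<le> defect_const"
proof -
  let ?E = "measure_pmf.expectation (sources L A)"
  define K where "K = 12 / \<mu>_min"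
  have K: "2 \<le> K" using \<mu>_min_pos \<mu>_min_le_1 by (simp add: K_def le_divide_eq)
  define a where "a k = n * prefix_weight z k" for k
  define s where "s k = sqrt (a k)" for k
  define b where "b k x = (if 1 \<le> a k then of_bool (level_count A x z k \<le> 1)
      else 2 * of_bool (1 \<le> level_count A x z k) :: real)" for k x
  have a_pos: "0 < a k" for k using prefix_weight_pos[of z k] A by (simp add: a_def)
  have s_pos: "0 < s k" and s_sq: "(s k)\<^sup>2 = a k" for k
    using a_pos[of k] by (simp_all add: s_def)
  have s_Suc: "s (Suc k) \<le> sqrt p_max * s k" for k
  proof -
    have "a (Suc k) \<le> p_max * a k"
      unfolding a_def using mult_left_mono[OF prefix_weight_Suc_le[of z k], of "real n"]
      by (simp add: mult.left_commute)
    then show ?thesis unfolding s_def real_sqrt_mult[symmetric] by simp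
  qed
  have bound: "?E (b k) \<le> K * (min (s k) (1 / s k))\<^sup>2" if k: "k < L" for k
  proof -
    define m where "m = card A * (\<mu> (z ! 0) * prefix_weight z k)"
    note mom = level_count_moments[OF A(1) k z(1), folded m_def]
    have m_eq: "m = (real n - 1) * \<mu> (z ! 0) * prefix_weight z k"
      using A by (simp add: m_def of_nat_diff)
    have "(real n - 1) * \<mu> (z ! 0) \<le> real n * 1"
      using A \<mu>_le_1 \<mu>_nonneg by (intro mult_mono) auto
    then have m_le: "m \<le> a k"
      unfolding m_eq a_def using prefix_weight_pos[of z k] by (intro mult_right_mono) auto
    \<comment> \<open>The half is \<open>n - 1 >= n / 2\<close>: the threshold uses
      \<open>n\<close>, but only the other \<open>n - 1\<close> strings are counted.\<close>
    have m_ge: "\<mu>_min * a k / 2 \<le> m"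
    proof -
      have "\<mu>_min * (real n / 2) \<le> \<mu> (z ! 0) * (real n - 1)"
        using \<mu>_min_le[OF z(2)] \<mu>_min_pos A by (intro mult_mono) auto
      then have "\<mu>_min * (real n / 2) * prefix_weight z k \<le> \<mu> (z ! 0) * (real n - 1) * prefix_weight z k"
        using prefix_weight_pos[of z k] by (intro mult_right_mono) auto
      then show ?thesis by (simp add: m_eq a_def mult_ac)
    qed
    have "0 < \<mu>_min * a k" using \<mu>_min_pos a_pos by simp
    with m_ge have m_pos: "0 < m" by linarith
    show ?thesis
    proof (cases "1 \<le> a k")
      case True
      let ?N = "\<lambda>x. real (level_count A x z k)"
      \<comment> \<open>For \<open>m >= 2\<close>, a count of at most 1 deviates from
        \<open>m\<close> by at least \<open>m / 2\<close>; for \<open>m < 2\<close>, the summand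
        \<open>2 / m\<close> alone exceeds 1.\<close>
      have pt: "of_bool (level_count A x z k \<le> 1) \<le> 4 / m\<^sup>2 * (?N x - m)\<^sup>2 + 2 / m" for x
      proof (cases "level_count A x z k \<le> 1 \<and> 2 \<le> m")
        case T: True
        then have "m / 2 \<le> m - ?N x" by linarith
        then have "(m / 2)\<^sup>2 \<le> (m - ?N x)\<^sup>2" using m_pos by (intro power_mono) auto
        then have "4 / m\<^sup>2 * (m / 2)\<^sup>2 \<le> 4 / m\<^sup>2 * (?N x - m)\<^sup>2"
          by (intro mult_left_mono) (auto simp: power2_commute)
        moreover have "4 / m\<^sup>2 * (m / 2)\<^sup>2 = 1" using m_pos by (simp add: power_divide)
        moreover have "0 \<le> 2 / m" using m_pos by simp
        ultimately have "1 \<le> 4 / m\<^sup>2 * (?N x - m)\<^sup>2 + 2 / m" by linarith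
        with T show ?thesis by (simp only: of_bool_eq)
      next
        case F: False
        have nn: "0 \<le> 4 / m\<^sup>2 * (?N x - m)\<^sup>2" by simp
        show ?thesis
        proof (cases "level_count A x z k \<le> 1")
          case True
          with F have "1 \<le> 2 / m" using m_pos by (simp add: le_divide_eq)
          with nn have "1 \<le> 4 / m\<^sup>2 * (?N x - m)\<^sup>2 + 2 / m" by linarith
          with True show ?thesis by (simp only: of_bool_eq)
        next
          case False
          have "0 \<le> 2 / m" using m_pos by simp
          with nn have "0 \<le> 4 / m\<^sup>2 * (?N x - m)\<^sup>2 + 2 / m" by linarith
          with False show ?thesis by (simp only: of_bool_eq)
        qed
      qed
      have "?E (b k) \<le> ?E (\<lambda>x. 4 / m\<^sup>2 * (?N x - m)\<^sup>2 + 2 / m)"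
        using A pt True by (intro expectation_pmf_mono) (simp_all add: b_def)
      also have "\<dots> = 4 / m\<^sup>2 * measure_pmf.variance (sources L A) ?N + 2 / m"
        using A mom(1) by simp
      also have "\<dots> \<le> 4 / m\<^sup>2 * m + 2 / m"
        using mom(2) by (intro add_right_mono mult_left_mono) auto
      also have "\<dots> = 6 / m" using m_pos by (simp add: power2_eq_square)
      also have "\<dots> \<le> 6 / (\<mu>_min * a k / 2)"
        using m_ge m_pos \<open>0 < \<mu>_min * a k\<close> by (intro divide_left_mono mult_pos_pos) auto
      also have "\<dots> = K * (1 / a k)" by (simp add: K_def)
      also have "1 / a k = (min (s k) (1 / s k))\<^sup>2"
      proof -
        have "1 \<le> s k" using True by (simp add: s_def)
        then have "1 * 1 \<le> s k * s k" by (intro mult_mono) auto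
        then have "min (s k) (1 / s k) = 1 / s k"
          using s_pos[of k] by (intro min_absorb2) (simp add: divide_le_eq)
        then show ?thesis using s_sq[of k] by (simp add: power_divide)
      qed
      finally show ?thesis .
    next
      case False
      have "?E (b k) \<le> ?E (\<lambda>x. 2 * real (level_count A x z k))"
        using A False by (intro expectation_pmf_mono) (auto simp: b_def of_bool_def)
      also have "\<dots> = 2 * m" using A mom(1) by simp
      also have "\<dots> \<le> K * a k" using K m_le a_pos[of k] m_pos by (intro mult_mono) auto
      also have "a k = (min (s k) (1 / s k))\<^sup>2"
      proof -
        have "s k < 1" using False by (simp add: s_def)
        then have "s k * s k \<le> 1 * 1" using s_pos[of k] by (intro mult_mono) auto
        then have "min (s k) (1 / s k) = s k"
          using s_pos[of k] by (intro min_absorb1) (simp add: le_divide_eq)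
        then show ?thesis using s_sq[of k] by simp
      qed
      finally show ?thesis .
    qed
  qed
  have "?E (\<lambda>x. (level_defect L n z A x)\<^sup>2) = ?E (\<lambda>x. (\<Sum>k<L. b k x)\<^sup>2)"
    by (simp add: level_defect_def b_def a_def)
  also have "\<dots> \<le> 2 * K * (\<Sum>k<L. min (s k) (1 / s k))\<^sup>2"
  proof (rule expectation_square_sum_le)
    show "0 \<le> min (s k) (1 / s k)" for k using s_pos[of k] by simp
  qed (use A bound K in \<open>auto simp: b_def[abs_def]\<close>)
  also have "\<dots> \<le> 2 * K * (2 / (1 - sqrt p_max))\<^sup>2"
  proof (intro mult_left_mono power_mono sum_min_geometric s_pos s_Suc sum_nonneg)
    show "0 < sqrt p_max" "sqrt p_max < 1" using p_max_pos p_max_less_1 by auto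
  qed (use K s_pos in \<open>auto intro: less_imp_le\<close>)
  finally show ?thesis unfolding K_def defect_const_def .
qed

section \<open>Effect of deleting one string, and moments of the remainder\<close>

definition remainder :: "nat \<Rightarrow> real \<Rightarrow> nat set \<Rightarrow> (nat \<Rightarrow> bool list) \<Rightarrow> real" where
  "remainder L c A x = (\<Sum>j\<in>A. depth L A x j) - (\<Sum>j\<in>A. level_tau c (x j))"

lemma level_tau_eq_sum:
  assumes "0 \<le> c" "length z = Suc L"
  shows "level_tau c z = (\<Sum>k<L. of_bool (1 \<le> c * prefix_weight z k))"
  using assms tau_eq_sum[of c "hd z" "tl z"] by (cases z) (auto simp: level_tau_def)

lemma depth_level_tau:
  assumes "finite A" "0 \<le> c" "length (x j) = Suc L"
  shows "\<bar>depth L A x j - level_tau c (x j)\<bar> \<le> level_defect L c (x j) (A - {j}) x"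
proof -
  let ?N = "level_count (A - {j}) x (x j)"
  have "depth L A x j = (\<Sum>k<L. of_bool (1 \<le> ?N k))"
    unfolding depth_def using assms
    by (intro sum.cong refl arg_cong[where f = of_bool]) (simp only: level_count_ge_1[OF finite_Diff[OF assms(1)]])
  then have "\<bar>depth L A x j - level_tau c (x j)\<bar>
    \<le> (\<Sum>k<L. \<bar>of_bool (1 \<le> ?N k) - of_bool (1 \<le> c * prefix_weight (x j) k)\<bar>)"
    using assms by (simp add: level_tau_eq_sum sum_subtractf[symmetric] sum_abs del: sum_of_bool_eq)
  also have "\<dots> \<le> level_defect L c (x j) (A - {j}) x"
    unfolding level_defect_def by (intro sum_mono) auto
  finally show ?thesis .
qed

text \<open>With \<open>N\<close> other strings at a level, the change is
  \<open>[N >= 1] + [N = 1]\<close>, minus 1 if the level passes the threshold test. In the passing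
  case this is \<open>-1\<close>, \<open>1\<close>, \<open>0\<close> for \<open>N = 0\<close>,
  \<open>N = 1\<close>, \<open>N >= 2\<close>; otherwise it is at most 2 and vanishes for
  \<open>N = 0\<close>. These are the two cases of \<open>level_defect\<close>.\<close>

lemma remainder_remove:
  assumes "finite A" "j \<in> A" "0 \<le> c" "length (x j) = Suc L"
  shows "\<bar>remainder L c A x - remainder L c (A - {j}) x\<bar> \<le> level_defect L c (x j) (A - {j}) x"
proof -
  let ?N = "level_count (A - {j}) x (x j)"
  have "remainder L c A x - remainder L c (A - {j}) x
    = (\<Sum>l\<in>A. depth L A x l) - (\<Sum>l\<in>A - {j}. depth L (A - {j}) x l) - level_tau c (x j)"
    using assms by (simp add: remainder_def sum.remove[of A j "\<lambda>j. level_tau c (x j)"])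
  also have "\<dots> = (\<Sum>k<L. of_bool (1 \<le> ?N k) + of_bool (?N k = 1) - of_bool (1 \<le> c * prefix_weight (x j) k))" (is "_ = ?S")
    unfolding depth_remove[OF assms(1,2)] using assms by (simp add: level_tau_eq_sum sum_subtractf del: sum_of_bool_eq)
  finally have eq: "remainder L c A x - remainder L c (A - {j}) x = ?S" .
  have "\<bar>?S\<bar> \<le> (\<Sum>k<L. \<bar>of_bool (1 \<le> ?N k) + of_bool (?N k = 1) - of_bool (1 \<le> c * prefix_weight (x j) k)\<bar>)"
    by (rule sum_abs)
  also have "\<dots> \<le> level_defect L c (x j) (A - {j}) x"
    unfolding level_defect_def by (intro sum_mono) auto
  finally show ?thesis unfolding eq .
qed

lemma length_sources:
  assumes "finite A" "x \<in> set_pmf (sources L A)" "j \<in> A"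
  shows "length (x j) = Suc L"
proof -
  have "x \<in> PiE_dflt A [] (set_pmf \<circ> (\<lambda>_. source L))"
    using assms(2) set_Pi_pmf_subset'[OF assms(1)] unfolding sources_def by (rule subsetD[rotated])
  then have "x j \<in> set_pmf (source L)"
    using assms(3) by (simp add: PiE_dflt_def)
  then show ?thesis by (rule set_pmf_source)
qed

text \<open>String \<open>j\<close> is independent of the strings in \<open>A - {j}\<close>, which
  are the only others involved, so conditioning on \<open>x j\<close> reduces the claim to a fixed
  \<open>z\<close>.\<close>

lemma expectation_level_defect_random:
  assumes "finite A" "j \<in> A" "2 \<le> card A"
  shows "measure_pmf.expectation (sources L A) (\<lambda>x. (level_defect L (card A) (x j) (A - {j}) x)\<^sup>2) \<le> defect_const"
proof -
  let ?B = "A - {j}" and ?n = "card A"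
  have A: "insert j ?B = A" using assms by auto
  have upd: "level_defect L c z ?B (x(j := y)) = level_defect L c z ?B x" for c z x y
  proof -
    have "level_count ?B (x(j := y)) z k = level_count ?B x z k" for k
      unfolding level_count_def by (intro arg_cong[where f = card]) auto
    then show ?thesis unfolding level_defect_def by (simp only:)
  qed
  have "measure_pmf.expectation (sources L A) (\<lambda>x. (level_defect L ?n (x j) ?B x)\<^sup>2)
    = measure_pmf.expectation (source L) (\<lambda>y. measure_pmf.expectation (sources L ?B) (\<lambda>x. (level_defect L ?n y ?B x)\<^sup>2))"
    using expectation_Pi_pmf_insert(1)[of ?B j "\<lambda>_. source L" "[]" "\<lambda>x. (level_defect L ?n (x j) ?B x)\<^sup>2"] assms
    unfolding A sources_def by (simp add: upd)
  also have "\<dots> \<le> measure_pmf.expectation (source L) (\<lambda>y. defect_const)"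
    using assms by (intro expectation_pmf_mono expectation_level_defect) (auto dest: set_pmf_source)
  finally show ?thesis by simp
qed

text \<open>Efron--Stein with the remainder of \<open>A - {j}\<close> as comparison. The threshold
  stays at \<open>card A\<close> there, so the \<open>level_tau\<close> terms of the other strings
  cancel.\<close>

lemma variance_remainder:
  assumes A: "finite A" "2 \<le> card A"
  shows "measure_pmf.variance (sources L A) (remainder L (card A) A) \<le> card A * defect_const"
proof -
  have "depth L (A - {j}) (x(j := y)) l = depth L (A - {j}) x l" if "l \<in> A - {j}" for j x y l
    unfolding depth_def using that
    by (intro sum.cong refl arg_cong[where f = of_bool] bex_cong) simp_all
  then have upd: "remainder L c (A - {j}) (x(j := y)) = remainder L c (A - {j}) x" for c j x y
    unfolding remainder_def by (intro arg_cong2[where f = minus] sum.cong[OF refl]) simp_all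
  have "measure_pmf.variance (sources L A) (remainder L (card A) A)
    \<le> (\<Sum>j\<in>A. measure_pmf.expectation (sources L A) (\<lambda>x. (remainder L (card A) A x - remainder L (card A) (A - {j}) x)\<^sup>2))"
    unfolding sources_def using A by (intro efron_stein) (auto simp: upd)
  also have "\<dots> \<le> (\<Sum>j\<in>A. measure_pmf.expectation (sources L A) (\<lambda>x. (level_defect L (card A) (x j) (A - {j}) x)\<^sup>2))"
  proof (intro sum_mono expectation_pmf_mono)
    fix j x assume "j \<in> A" "x \<in> set_pmf (sources L A)"
    then have "\<bar>remainder L (card A) A x - remainder L (card A) (A - {j}) x\<bar> \<le> level_defect L (card A) (x j) (A - {j}) x"
      using A by (intro remainder_remove) (auto simp: length_sources)
    then show "(remainder L (card A) A x - remainder L (card A) (A - {j}) x)\<^sup>2 \<le> (level_defect L (card A) (x j) (A - {j}) x)\<^sup>2"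
      by (metis abs_ge_zero power2_abs power_mono)
  qed (use A in auto)
  also have "\<dots> \<le> (\<Sum>j\<in>A. defect_const)"
    using A by (intro sum_mono expectation_level_defect_random)
  finally show ?thesis by simp
qed

lemma expectation_remainder:
  assumes A: "finite A" "2 \<le> card A"
  shows "\<bar>measure_pmf.expectation (sources L A) (remainder L (card A) A)\<bar> \<le> card A * (1 + defect_const)"
proof -
  let ?E = "measure_pmf.expectation (sources L A)"
  have "\<bar>?E (remainder L (card A) A)\<bar> \<le> ?E (\<lambda>x. \<bar>remainder L (card A) A x\<bar>)"
    by (rule integral_abs_bound)
  also have "\<dots> \<le> ?E (\<lambda>x. \<Sum>j\<in>A. 1 + (level_defect L (card A) (x j) (A - {j}) x)\<^sup>2)"
  proof (intro expectation_pmf_mono)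
    fix x assume x: "x \<in> set_pmf (sources L A)"
    have "\<bar>remainder L (card A) A x\<bar> \<le> (\<Sum>j\<in>A. \<bar>depth L A x j - level_tau (card A) (x j)\<bar>)"
      unfolding remainder_def sum_subtractf[symmetric] by (rule sum_abs)
    also have "\<dots> \<le> (\<Sum>j\<in>A. 1 + (level_defect L (card A) (x j) (A - {j}) x)\<^sup>2)"
    proof (rule sum_mono)
      fix j assume "j \<in> A"
      then have "\<bar>depth L A x j - level_tau (card A) (x j)\<bar> \<le> level_defect L (card A) (x j) (A - {j}) x"
        using A x by (intro depth_level_tau) (auto simp: length_sources)
      \<comment> \<open>Lets the second-moment bound for the defect serve for the mean as
        well.\<close>
      also have "d \<le> 1 + d\<^sup>2" for d :: real
        using zero_le_power2[of "d - 1 / 2"] by (simp add: power2_eq_square algebra_simps)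
      finally show "\<bar>depth L A x j - level_tau (card A) (x j)\<bar> \<le> 1 + (level_defect L (card A) (x j) (A - {j}) x)\<^sup>2" .
    qed
    finally show "\<bar>remainder L (card A) A x\<bar> \<le> (\<Sum>j\<in>A. 1 + (level_defect L (card A) (x j) (A - {j}) x)\<^sup>2)" .
  qed (use A in auto)
  also have "\<dots> = (\<Sum>j\<in>A. 1 + ?E (\<lambda>x. (level_defect L (card A) (x j) (A - {j}) x)\<^sup>2))"
    using A by simp
  also have "\<dots> \<le> (\<Sum>j\<in>A. 1 + defect_const)"
    using A by (intro sum_mono add_left_mono expectation_level_defect_random)
  finally show ?thesis by simp
qed

end

section \<open>Moments of the level-crossing time\<close>

lemma Pi_pmf_sum_second_moment:
  fixes f :: "'b \<Rightarrow> real"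
  assumes fin: "finite (set_pmf q)" and f: "measure_pmf.expectation q f = 0" and A: "finite A"
  shows "measure_pmf.expectation (Pi_pmf A d (\<lambda>_. q)) (\<lambda>x. \<Sum>j\<in>A. f (x j)) = 0"
    and "measure_pmf.expectation (Pi_pmf A d (\<lambda>_. q)) (\<lambda>x. (\<Sum>j\<in>A. f (x j))\<^sup>2)
      = card A * measure_pmf.expectation q (\<lambda>y. (f y)\<^sup>2)"
proof -
  have fP: "finite (set_pmf (Pi_pmf A d (\<lambda>_. q)))" if "finite A" for A
    using fin that by (intro finite_set_Pi_pmf) auto
  note [simp] = integrable_measure_pmf_finite[OF fP] integrable_measure_pmf_finite[OF fin]
  have E1: "measure_pmf.expectation (Pi_pmf A d (\<lambda>_. q)) (\<lambda>x. \<Sum>j\<in>A. f (x j)) = 0" if "finite A" for A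
  proof -
    have "measure_pmf.expectation (Pi_pmf A d (\<lambda>_. q)) (\<lambda>x. f (x j)) = 0" if "j \<in> A" for j
    proof -
      have "q = map_pmf (\<lambda>x. x j) (Pi_pmf A d (\<lambda>_. q))"
        using that \<open>finite A\<close> by (subst Pi_pmf_component) auto
      then have "measure_pmf.expectation q f = measure_pmf.expectation (map_pmf (\<lambda>x. x j) (Pi_pmf A d (\<lambda>_. q))) f"
        by (rule arg_cong)
      with f show ?thesis by simp
    qed
    with that show ?thesis by simp
  qed
  then show "measure_pmf.expectation (Pi_pmf A d (\<lambda>_. q)) (\<lambda>x. \<Sum>j\<in>A. f (x j)) = 0"
    using A by blast
  show "measure_pmf.expectation (Pi_pmf A d (\<lambda>_. q)) (\<lambda>x. (\<Sum>j\<in>A. f (x j))\<^sup>2)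
      = card A * measure_pmf.expectation q (\<lambda>y. (f y)\<^sup>2)"
    using A
  proof (induction A rule: finite_induct)
    case (insert a A)
    let ?S = "\<lambda>x. \<Sum>j\<in>A. f (x j)" and ?P = "Pi_pmf A d (\<lambda>_. q)"
    have upd: "(\<Sum>j\<in>insert a A. f ((x(a := y)) j)) = f y + ?S x" for x y
    proof -
      have "(\<Sum>j\<in>A. f ((x(a := y)) j)) = ?S x"
        using insert.hyps by (intro sum.cong) auto
      then show ?thesis using insert.hyps by simp
    qed
    have "measure_pmf.expectation (Pi_pmf (insert a A) d (\<lambda>_. q)) (\<lambda>x. (\<Sum>j\<in>insert a A. f (x j))\<^sup>2)
      = measure_pmf.expectation q (\<lambda>y. measure_pmf.expectation ?P (\<lambda>x. (f y + ?S x)\<^sup>2))"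
      unfolding expectation_Pi_pmf_insert(1)[OF insert.hyps fin] upd ..
    also have "\<dots> = measure_pmf.expectation q (\<lambda>y. (f y)\<^sup>2 + measure_pmf.expectation ?P (\<lambda>x. (?S x)\<^sup>2))"
    proof (rule Bochner_Integration.integral_cong[OF refl])
      fix y
      have "measure_pmf.expectation ?P (\<lambda>x. (f y + ?S x)\<^sup>2)
        = measure_pmf.expectation ?P (\<lambda>x. (f y)\<^sup>2 + 2 * f y * ?S x + (?S x)\<^sup>2)"
        by (simp only: power2_sum ac_simps)
      also have "\<dots> = (f y)\<^sup>2 + 2 * f y * measure_pmf.expectation ?P ?S + measure_pmf.expectation ?P (\<lambda>x. (?S x)\<^sup>2)"
        using insert.hyps by simp
      finally show "measure_pmf.expectation ?P (\<lambda>x. (f y + ?S x)\<^sup>2)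
        = (f y)\<^sup>2 + measure_pmf.expectation ?P (\<lambda>x. (?S x)\<^sup>2)"
        using E1[OF insert.hyps(1)] by simp
    qed
    also have "\<dots> = card (insert a A) * measure_pmf.expectation q (\<lambda>y. (f y)\<^sup>2)"
      using insert.hyps insert.IH by (simp add: distrib_right)
    finally show ?case .
  qed simp
qed

lemma Pi_pmf_sum_moments:
  fixes t :: "'b \<Rightarrow> real"
  assumes fin: "finite (set_pmf q)" and A: "finite A"
  shows "measure_pmf.expectation (Pi_pmf A d (\<lambda>_. q)) (\<lambda>x. \<Sum>j\<in>A. t (x j)) = card A * measure_pmf.expectation q t"
    and "measure_pmf.variance (Pi_pmf A d (\<lambda>_. q)) (\<lambda>x. \<Sum>j\<in>A. t (x j)) = card A * measure_pmf.variance q t"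
proof -
  define m where "m = measure_pmf.expectation q t"
  have fP: "finite (set_pmf (Pi_pmf A d (\<lambda>_. q)))"
    using fin A by (intro finite_set_Pi_pmf) auto
  note [simp] = integrable_measure_pmf_finite[OF fP] integrable_measure_pmf_finite[OF fin]
  have m0: "measure_pmf.expectation q (\<lambda>y. t y - m) = 0" by (simp add: m_def)
  note mom = Pi_pmf_sum_second_moment[OF fin m0 A, of d]
  have s: "(\<Sum>j\<in>A. t (x j) - m) = (\<Sum>j\<in>A. t (x j)) - card A * m" for x
    by (simp add: sum_subtractf)
  show E: "measure_pmf.expectation (Pi_pmf A d (\<lambda>_. q)) (\<lambda>x. \<Sum>j\<in>A. t (x j)) = card A * measure_pmf.expectation q t"
    using mom(1) unfolding s by (simp add: m_def)
  show "measure_pmf.variance (Pi_pmf A d (\<lambda>_. q)) (\<lambda>x. \<Sum>j\<in>A. t (x j)) = card A * measure_pmf.variance q t"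
    using mom(2) unfolding s E by (simp only: m_def)
qed

lemma variance_perturbation:
  fixes v x y s k t :: real
  assumes "\<bar>v - x\<bar> \<le> 2 * sqrt (x * y) + y" "\<bar>x - s\<bar> \<le> k" "y \<le> t" "0 \<le> x" "0 \<le> y"
  shows "\<bar>v - s\<bar> \<le> k + 2 * sqrt ((s + k) * t) + t"
proof -
  have "x * y \<le> (s + k) * t"
    using assms by (intro mult_mono) linarith+
  then have "sqrt (x * y) \<le> sqrt ((s + k) * t)" by (rule real_sqrt_le_mono)
  with assms show ?thesis by linarith
qed

context markov_source
begin

definition level_mart :: "real \<Rightarrow> bool list \<Rightarrow> real" where
  "level_mart c z = mart c (hd z) (tl z)"

text \<open>One copy of the potential bounds its value at the stopping time, the other its value at
  the first symbol; \<open>mart_const\<close> is formed in the same way.\<close>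

definition tau_const :: real where
  "tau_const = \<bar>ln p_min\<bar> / H + 2 * \<bar>potential False\<bar>"

definition mart_const :: real where
  "mart_const = \<bar>sigma2 p * ln p_min\<bar> + 2 * \<bar>var_potential False\<bar>"

lemma level_tau_mart:
  assumes "p_min \<le> c" "c * p_max ^ L < 1" "length z = Suc L"
  shows "\<bar>level_tau c z - level_mart c z - ln c / H\<bar> \<le> tau_const"
proof -
  have "\<bar>potential (hd z)\<bar> \<le> \<bar>potential False\<bar>" by (simp add: potential_def)
  with tau_mart[of c "tl z" "hd z"] assms show ?thesis
    unfolding level_tau_def level_mart_def tau_const_def by simp
qed

lemma expectation_level_mart: "measure_pmf.expectation (source L) (level_mart c) = 0"
  unfolding expectation_source level_mart_def using expectation_mart by simp

lemma expectation_level_mart_square: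
  assumes "p_min \<le> c" "c * p_max ^ L < 1"
  shows "\<bar>measure_pmf.expectation (source L) (\<lambda>z. (level_mart c z)\<^sup>2) - sigma2 p * ln c\<bar> \<le> mart_const"
proof -
  define e where "e i = measure_pmf.expectation (chain L i) (\<lambda>ys. (mart c i ys)\<^sup>2) - sigma2 p * ln c" for i
  have e: "\<bar>e i\<bar> \<le> mart_const" for i
  proof -
    have "\<bar>var_potential i\<bar> \<le> \<bar>var_potential False\<bar>" by (simp add: var_potential_def)
    with expectation_mart_square[OF assms, of i] show ?thesis
      unfolding e_def mart_const_def by linarith
  qed
  have "sigma2 p * ln c = \<mu> False * (sigma2 p * ln c) + \<mu> True * (sigma2 p * ln c)"
    using \<mu>_sum by (simp flip: distrib_right)
  then have "measure_pmf.expectation (source L) (\<lambda>z. (level_mart c z)\<^sup>2) - sigma2 p * ln c = \<mu> False * e False + \<mu> True * e True"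
    unfolding expectation_source level_mart_def e_def list.sel right_diff_distrib by linarith
  moreover have "\<bar>\<mu> False * e False + \<mu> True * e True\<bar> \<le> \<mu> False * \<bar>e False\<bar> + \<mu> True * \<bar>e True\<bar>"
    using \<mu>_nonneg by (intro abs_triangle_ineq[THEN order_trans]) (simp add: abs_mult)
  moreover have "\<mu> False * \<bar>e False\<bar> + \<mu> True * \<bar>e True\<bar> \<le> \<mu> False * mart_const + \<mu> True * mart_const"
    using e \<mu>_nonneg by (intro add_mono mult_left_mono)
  moreover have "\<mu> False * mart_const + \<mu> True * mart_const = mart_const"
    using \<mu>_sum by (simp flip: distrib_right)
  ultimately show ?thesis by linarith
qed

lemma expectation_level_tau:
  assumes "p_min \<le> c" "c * p_max ^ L < 1"
  shows "\<bar>measure_pmf.expectation (source L) (level_tau c) - ln c / H\<bar> \<le> tau_const"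
proof -
  have "measure_pmf.expectation (source L) (level_tau c) - ln c / H
    = measure_pmf.expectation (source L) (\<lambda>z. level_tau c z - level_mart c z - ln c / H)"
    using expectation_level_mart[of L c] by simp
  then have "\<bar>measure_pmf.expectation (source L) (level_tau c) - ln c / H\<bar>
    \<le> measure_pmf.expectation (source L) (\<lambda>z. \<bar>level_tau c z - level_mart c z - ln c / H\<bar>)"
    by (simp only: integral_abs_bound)
  also have "\<dots> \<le> measure_pmf.expectation (source L) (\<lambda>z. tau_const)"
    using assms set_pmf_source(1) by (intro expectation_pmf_mono level_tau_mart) auto
  finally show ?thesis by simp
qed

text \<open>\<open>level_tau c - level_mart c\<close> stays within \<open>tau_const\<close> of the
  constant \<open>ln c / H\<close>, so its variance is bounded; \<open>level_mart c\<close> has mean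
  zero, so its variance is the second moment already computed.\<close>

lemma variance_level_tau:
  assumes "1 \<le> c" "c * p_max ^ L < 1"
  shows "\<bar>measure_pmf.variance (source L) (level_tau c) - sigma2 p * ln c\<bar>
    \<le> mart_const + 2 * sqrt ((sigma2 p * ln c + mart_const) * tau_const\<^sup>2) + tau_const\<^sup>2"
proof -
  have c: "p_min \<le> c"
    using assms p_min_le[of True True] p_less_1[of True True] by linarith
  let ?X = "level_mart c" and ?Y = "\<lambda>z. level_tau c z - level_mart c z"
  have "\<bar>measure_pmf.variance (source L) (\<lambda>z. ?X z + ?Y z) - measure_pmf.variance (source L) ?X\<bar>
    \<le> 2 * sqrt (measure_pmf.variance (source L) ?X * measure_pmf.variance (source L) ?Y) + measure_pmf.variance (source L) ?Y"
    by (rule measure_pmf.variance_add_bound) simp_all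
  moreover have "\<bar>measure_pmf.variance (source L) ?X - sigma2 p * ln c\<bar> \<le> mart_const"
    using expectation_level_mart_square[OF c assms(2)] expectation_level_mart[of L c] by simp
  moreover have "measure_pmf.variance (source L) ?Y \<le> tau_const\<^sup>2"
  proof -
    have "measure_pmf.variance (source L) ?Y \<le> measure_pmf.expectation (source L) (\<lambda>z. (?Y z - ln c / H)\<^sup>2)"
      using second_moment_eq_variance[OF finite_set_source, of L ?Y "ln c / H"] by simp
    also have "\<dots> \<le> measure_pmf.expectation (source L) (\<lambda>z. tau_const\<^sup>2)"
    proof (intro expectation_pmf_mono finite_set_source)
      fix z assume "z \<in> set_pmf (source L)"
      then have "\<bar>?Y z - ln c / H\<bar> \<le> tau_const"
        using level_tau_mart[OF c assms(2)] set_pmf_source(1) by blast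
      then show "(?Y z - ln c / H)\<^sup>2 \<le> tau_const\<^sup>2"
        by (metis abs_ge_zero power2_abs power_mono)
    qed
    finally show ?thesis by simp
  qed
  ultimately have "\<bar>measure_pmf.variance (source L) (\<lambda>z. ?X z + ?Y z) - sigma2 p * ln c\<bar>
    \<le> mart_const + 2 * sqrt ((sigma2 p * ln c + mart_const) * tau_const\<^sup>2) + tau_const\<^sup>2"
    by (rule variance_perturbation) (rule measure_pmf.variance_positive)+
  then show ?thesis by simp
qed

lemma level_tau_take:
  assumes "c * p_max ^ L < 1" "0 \<le> c" "Suc L \<le> length z"
  shows "level_tau c z = level_tau c (take (Suc L) z)"
proof -
  obtain i ys where z: "z = i # ys" using assms by (cases z) auto
  have "tau c i (take L ys @ drop L ys) = tau c i (take L ys)"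
    using assms z by (intro tau_append) auto
  then show ?thesis by (simp add: level_tau_def z)
qed

lemma level_tau_nonneg: "0 \<le> level_tau c z"
  by (simp add: level_tau_def tau_nonneg)

lemma level_tau_le:
  assumes "1 \<le> c"
  shows "level_tau c z \<le> 1 + ln c / (- ln p_max)"
proof -
  have l: "0 < - ln p_max" using p_max_pos p_max_less_1 by simp
  have "level_tau c z * (- ln p_max) \<le> max 0 (- ln p_max + ln c)"
    unfolding level_tau_def using assms by (intro tau_le) simp
  also have "max 0 (- ln p_max + ln c) = - ln p_max + ln c"
    using ln_ge_zero[OF assms] l by (intro max_absorb2) linarith
  finally have "level_tau c z \<le> (- ln p_max + ln c) / (- ln p_max)"
    using l by (simp add: pos_le_divide_eq del: minus_le_iff mult_minus_right divide_minus_right)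
  also have "\<dots> = 1 + ln c / (- ln p_max)"
    using l unfolding add_divide_distrib by (subst divide_self) simp_all
  finally show ?thesis .
qed

end

section \<open>Transfer to the infinite strings\<close>

definition shared_levels :: "(nat \<Rightarrow> nat \<Rightarrow> bool) \<Rightarrow> nat \<Rightarrow> nat \<Rightarrow> nat \<Rightarrow> real" where
  "shared_levels x n L j = (\<Sum>k<L. of_bool (\<exists>l<n. l \<noteq> j \<and> (\<forall>i\<le>k. x l i = x j i)))"

text \<open>The root level, which contributes \<open>n\<close> operations, is not counted here.\<close>

definition truncated_ops :: "(nat \<Rightarrow> nat \<Rightarrow> bool) \<Rightarrow> nat \<Rightarrow> nat \<Rightarrow> real" where
  "truncated_ops x n L = (\<Sum>j<n. shared_levels x n L j)"

lemma shared_levels_nonneg: "0 \<le> shared_levels x n L j"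
  unfolding shared_levels_def by (intro sum_nonneg) simp

lemma shared_levels_mono: "L \<le> L' \<Longrightarrow> shared_levels x n L j \<le> shared_levels x n L' j"
  unfolding shared_levels_def by (intro sum_mono2) auto

lemma truncated_ops_nonneg: "0 \<le> truncated_ops x n L"
  unfolding truncated_ops_def by (intro sum_nonneg shared_levels_nonneg)

lemma truncated_ops_mono: "L \<le> L' \<Longrightarrow> truncated_ops x n L \<le> truncated_ops x n L'"
  unfolding truncated_ops_def by (intro sum_mono shared_levels_mono)

text \<open>Level \<open>k\<close> is shared exactly if \<open>k + 1\<close> symbols do not yet
  separate string \<open>j\<close>, that is, if \<open>k + 1\<close> is less than the depth. With
  \<open>n >= 2\<close> the depth is positive, so the number of such levels is the depth minus
  one.\<close>

lemma shared_levels_eq_trie_depth: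
  assumes n: "2 \<le> n" "j < n" and distinct: "\<And>l. l < n \<Longrightarrow> l \<noteq> j \<Longrightarrow> \<exists>i. x l i \<noteq> x j i"
  shows "\<exists>L0. \<forall>L\<ge>L0. shared_levels x n L j = real (trie_depth x n j) - 1"
proof -
  define P where "P k \<longleftrightarrow> (\<forall>l<n. l \<noteq> j \<longrightarrow> (\<exists>i<k. x l i \<noteq> x j i))" for k
  define D where "D = trie_depth x n j"
  have D: "D = (LEAST k. P k)"
    unfolding D_def trie_depth_def P_def by (intro arg_cong[where f = Least] ext) blast
  have "\<forall>l\<in>{..<n} - {j}. \<exists>i. x l i \<noteq> x j i"
    using distinct by auto
  then obtain f where f: "\<And>l. l < n \<Longrightarrow> l \<noteq> j \<Longrightarrow> x l (f l) \<noteq> x j (f l)"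
    unfolding bchoice_iff by auto
  \<comment> \<open>The sum of all separating positions bounds each of them, so one prefix length
    separates \<open>j\<close> from every other string.\<close>
  have "P (Suc (\<Sum>l<n. f l))"
    unfolding P_def
  proof (intro allI impI)
    fix l assume l: "l < n" "l \<noteq> j"
    have "f l \<le> (\<Sum>l<n. f l)" using l by (intro member_le_sum) auto
    then show "\<exists>i<Suc (\<Sum>l<n. f l). x l i \<noteq> x j i"
      using f[OF l] by (intro exI[of _ "f l"]) simp
  qed
  then have PD: "P D" unfolding D by (rule LeastI)
  have mono: "P k \<longleftrightarrow> D \<le> k" for k
  proof
    assume "D \<le> k"
    with PD show "P k" unfolding P_def by (meson less_le_trans)
  qed (simp add: D Least_le)
  have "\<not> P 0"
  proof -
    obtain l where "l < n" "l \<noteq> j"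
      using n that[of "if j = 0 then 1 else 0"] by (auto split: if_splits)
    then show ?thesis unfolding P_def by auto
  qed
  then have "0 < D" using mono[of 0] by simp
  have ex: "(\<exists>l<n. l \<noteq> j \<and> (\<forall>i\<le>k. x l i = x j i)) \<longleftrightarrow> Suc k < D" for k
  proof -
    have "(\<exists>l<n. l \<noteq> j \<and> (\<forall>i\<le>k. x l i = x j i)) \<longleftrightarrow> \<not> P (Suc k)"
      unfolding P_def by (auto simp: less_Suc_eq_le)
    then show ?thesis using mono[of "Suc k"] by (simp add: not_le)
  qed
  have "shared_levels x n L j = real D - 1" if "D \<le> L" for L
  proof -
    have "{..<L} \<inter> {k. Suc k < D} = {..<D - 1}"
      using that by auto
    then show ?thesis
      using \<open>0 < D\<close> unfolding shared_levels_def ex by (simp add: of_nat_diff)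
  qed
  then show ?thesis unfolding D_def by blast
qed

lemma truncated_ops_eventually:
  assumes n: "2 \<le> n" and distinct: "\<And>j l. j < n \<Longrightarrow> l < n \<Longrightarrow> l \<noteq> j \<Longrightarrow> \<exists>i. x l i \<noteq> x j i"
  shows "\<forall>\<^sub>F L in sequentially. truncated_ops x n L = real (bucket_ops x n) - real n"
proof -
  have "\<forall>\<^sub>F L in sequentially. \<forall>j\<in>{..<n}. shared_levels x n L j = real (trie_depth x n j) - 1"
    using shared_levels_eq_trie_depth[OF n _ distinct]
    by (intro eventually_ball_finite) (auto simp: eventually_sequentially)
  then show ?thesis
  proof eventually_elim
    case (elim L)
    then have "truncated_ops x n L = (\<Sum>j<n. real (trie_depth x n j) - 1)"
      unfolding truncated_ops_def by (intro sum.cong) auto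
    then show ?case by (simp add: bucket_ops_def sum_subtractf)
  qed
qed

text \<open>Equal strings share every level. This linear growth in \<open>L\<close> will contradict
  the uniform second-moment bound unless equality has probability zero.\<close>

lemma truncated_ops_equal_strings:
  assumes "j < n" "l < n" "l \<noteq> j" "\<And>i. x l i = x j i"
  shows "real L \<le> truncated_ops x n L"
proof -
  have "real L = shared_levels x n L j"
    unfolding shared_levels_def using assms by (subst sum.cong[where h = "\<lambda>_. 1" and B = "{..<L}"]) auto
  also have "\<dots> \<le> truncated_ops x n L"
    unfolding truncated_ops_def using assms by (intro member_le_sum shared_levels_nonneg) auto
  finally show ?thesis .
qed

lemma map_upt_eq_iff: "map f [0..<Suc k] = map g [0..<Suc k] \<longleftrightarrow> (\<forall>i\<le>k. f i = g i)"
  by (simp add: less_Suc_eq_le Ball_def del: upt_Suc)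

section \<open>Random strings given by their cylinder probabilities\<close>

locale random_trie = markov_source p \<mu> + prob_space M
  for p :: "bool \<Rightarrow> bool \<Rightarrow> real" and \<mu> :: "bool \<Rightarrow> real" and M :: "'a measure" +
  fixes X :: "nat \<Rightarrow> nat \<Rightarrow> 'a \<Rightarrow> bool"
  assumes X_meas [measurable]: "\<And>j i. X j i \<in> measurable M (count_space UNIV)"
    and X_law: "\<And>n k (s :: nat \<Rightarrow> nat \<Rightarrow> bool).
       measure M {\<omega> \<in> space M. \<forall>j<n. \<forall>i\<le>k. X j i \<omega> = s j i}
         = (\<Prod>j<n. \<mu> (s j 0) * (\<Prod>i<k. p (s j i) (s j (Suc i))))"
begin

text \<open>Indices from \<open>n\<close> on receive \<open>[]\<close>, the default value in
  \<open>sources\<close>, so that both laws live on the same set of functions.\<close>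

definition prefixes :: "nat \<Rightarrow> nat \<Rightarrow> 'a \<Rightarrow> nat \<Rightarrow> bool list" where
  "prefixes L n \<omega> j = (if j < n then map (\<lambda>i. X j i \<omega>) [0..<Suc L] else [])"

text \<open>The prefixes take finitely many values, so any function of them is a finite combination
  of indicators of cylinder events; \<open>X_law\<close> and \<open>pmf_source\<close> assign these
  the same probabilities.\<close>

lemma prefixes_transfer:
  fixes f :: "(nat \<Rightarrow> bool list) \<Rightarrow> 'b :: {banach, second_countable_topology}"
  shows "integrable M (\<lambda>\<omega>. f (prefixes L n \<omega>))"
    and "integral\<^sup>L M (\<lambda>\<omega>. f (prefixes L n \<omega>)) = integral\<^sup>L (measure_pmf (sources L {..<n})) f"
proof -
  define A where "A = PiE_dflt {..<n} [] (\<lambda>_. {z :: bool list. length z = Suc L})"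
  have finA: "finite A"
    unfolding A_def using finite_lists_length_eq[of "UNIV :: bool set" "Suc L"] by (intro finite_PiE_dflt) auto
  have inA: "prefixes L n \<omega> \<in> A" for \<omega>
    by (auto simp: A_def PiE_dflt_def prefixes_def)
  define S where "S s = {\<omega> \<in> space M. \<forall>j<n. \<forall>i\<le>L. X j i \<omega> = s j ! i}" for s :: "nat \<Rightarrow> bool list"
  have S_iff: "\<omega> \<in> S s \<longleftrightarrow> prefixes L n \<omega> = s" if "s \<in> A" "\<omega> \<in> space M" for s \<omega>
  proof -
    have dflt: "s j = []" if "\<not> j < n" for j
      using \<open>s \<in> A\<close> that by (simp add: A_def PiE_dflt_def)
    have s: "s j = map (\<lambda>i. s j ! i) [0..<Suc L]" if "j < n" for j
      using \<open>s \<in> A\<close> that map_nth[of "s j"] by (simp add: A_def PiE_dflt_def)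
    have "prefixes L n \<omega> = s \<longleftrightarrow> (\<forall>j<n. map (\<lambda>i. X j i \<omega>) [0..<Suc L] = s j)"
      using dflt by (simp add: prefixes_def fun_eq_iff del: upt_Suc)
    also have "\<dots> \<longleftrightarrow> (\<forall>j<n. map (\<lambda>i. X j i \<omega>) [0..<Suc L] = map (\<lambda>i. s j ! i) [0..<Suc L])"
      using s by metis
    also have "\<dots> \<longleftrightarrow> (\<forall>j<n. \<forall>i\<le>L. X j i \<omega> = s j ! i)"
      by (simp only: map_upt_eq_iff)
    finally show ?thesis using that by (simp add: S_def)
  qed
  have S_sets [measurable]: "S s \<in> sets M" for s
    unfolding S_def by measurable
  have S_prob: "measure M (S s) = pmf (sources L {..<n}) s" if "s \<in> A" for s
  proof -
    have len: "length (s j) = Suc L" if "j < n" for j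
      using \<open>s \<in> A\<close> that by (auto simp: A_def PiE_dflt_def)
    have "pmf (sources L {..<n}) s = (\<Prod>j<n. pmf (source L) (s j))"
      unfolding sources_def using \<open>s \<in> A\<close> by (intro pmf_Pi') (auto simp: A_def PiE_dflt_def)
    also have "\<dots> = (\<Prod>j<n. \<mu> (s j ! 0) * (\<Prod>i<L. p (s j ! i) (s j ! Suc i)))"
      using len by (intro prod.cong refl) (simp add: pmf_source prefix_weight_def)
    also have "\<dots> = measure M (S s)"
      unfolding S_def by (rule X_law[symmetric])
    finally show ?thesis ..
  qed
  have eq: "f (prefixes L n \<omega>) = (\<Sum>s\<in>A. indicator (S s) \<omega> *\<^sub>R f s)" if "\<omega> \<in> space M" for \<omega>
  proof -
    have "(\<Sum>s\<in>A. indicator (S s) \<omega> *\<^sub>R f s) = (\<Sum>s\<in>A. if s = prefixes L n \<omega> then f s else 0)"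
      using that by (intro sum.cong refl) (auto simp: S_iff indicator_def)
    then show ?thesis using finA inA by simp
  qed
  have int: "integrable M (\<lambda>\<omega>. \<Sum>s\<in>A. indicator (S s) \<omega> *\<^sub>R f s)"
    by (intro Bochner_Integration.integrable_sum integrable_scaleR_left integrable_real_indicator) (auto simp: less_top[symmetric])
  then show "integrable M (\<lambda>\<omega>. f (prefixes L n \<omega>))"
    using eq by (simp cong: Bochner_Integration.integrable_cong)
  have "integral\<^sup>L M (\<lambda>\<omega>. f (prefixes L n \<omega>)) = integral\<^sup>L M (\<lambda>\<omega>. \<Sum>s\<in>A. indicator (S s) \<omega> *\<^sub>R f s)"
    using eq by (rule Bochner_Integration.integral_cong[OF refl])
  also have "\<dots> = (\<Sum>s\<in>A. measure M (S s) *\<^sub>R f s)"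
    by (subst Bochner_Integration.integral_sum) (auto simp: less_top[symmetric])
  also have "\<dots> = (\<Sum>s\<in>A. pmf (sources L {..<n}) s *\<^sub>R f s)"
    by (intro sum.cong refl) (simp add: S_prob)
  also have "\<dots> = integral\<^sup>L (measure_pmf (sources L {..<n})) f"
  proof (intro integral_measure_pmf[symmetric] finA)
    fix s assume s: "s \<in> set_pmf (sources L {..<n})"
    then have "s \<in> PiE_dflt {..<n} [] (set_pmf \<circ> (\<lambda>_. source L))"
      unfolding sources_def by (rule subsetD[OF set_Pi_pmf_subset', rotated]) simp
    then show "s \<in> A"
      using set_pmf_source(1) by (auto simp: A_def PiE_dflt_def)
  qed
  finally show "integral\<^sup>L M (\<lambda>\<omega>. f (prefixes L n \<omega>)) = integral\<^sup>L (measure_pmf (sources L {..<n})) f" .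
qed

lemma agree_prefixes:
  assumes "k < L" "l < n" "j < n"
  shows "agree k (prefixes L n \<omega> l) (prefixes L n \<omega> j) \<longleftrightarrow> (\<forall>i\<le>k. X l i \<omega> = X j i \<omega>)"
proof -
  have "take (Suc k) (prefixes L n \<omega> l) = map (\<lambda>i. X l i \<omega>) [0..<Suc k]" if "l < n" for l
    unfolding prefixes_def using that assms(1) by (simp add: take_map take_upt del: upt_Suc)
  then show ?thesis
    unfolding agree_def using assms(2,3) map_upt_eq_iff by (simp only:)
qed

lemma depth_prefixes:
  assumes "j < n"
  shows "depth L {..<n} (prefixes L n \<omega>) j = shared_levels (\<lambda>j i. X j i \<omega>) n L j"
  unfolding depth_def shared_levels_def
proof (intro sum.cong refl arg_cong[where f = of_bool])
  fix k assume "k \<in> {..<L}"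
  then have "agree k (prefixes L n \<omega> l) (prefixes L n \<omega> j) \<longleftrightarrow> (\<forall>i\<le>k. X l i \<omega> = X j i \<omega>)" if "l < n" for l
    using assms that by (intro agree_prefixes) auto
  then show "(\<exists>l\<in>{..<n} - {j}. agree k (prefixes L n \<omega> l) (prefixes L n \<omega> j))
    \<longleftrightarrow> (\<exists>l<n. l \<noteq> j \<and> (\<forall>i\<le>k. X l i \<omega> = X j i \<omega>))"
    by blast
qed

lemma truncated_ops_prefixes:
  "truncated_ops (\<lambda>j i. X j i \<omega>) n L = (\<Sum>j<n. depth L {..<n} (prefixes L n \<omega>) j)"
  unfolding truncated_ops_def by (intro sum.cong refl depth_prefixes[symmetric]) simp

text \<open>With this many transitions every string crosses the threshold \<open>n\<close>, whatever
  its symbols, since each transition multiplies by at most \<open>p_max\<close>.\<close>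

definition threshold_level :: "nat \<Rightarrow> nat" where
  "threshold_level n = (SOME L. real n * p_max ^ L < 1)"

lemma threshold_level: "threshold_level n \<le> L \<Longrightarrow> real n * p_max ^ L < 1"
proof -
  assume L: "threshold_level n \<le> L"
  have "(\<lambda>L. real n * p_max ^ L) \<longlonglongrightarrow> real n * 0"
    using p_max_pos p_max_less_1 by (intro tendsto_mult tendsto_const LIMSEQ_realpow_zero) auto
  then have "\<forall>\<^sub>F L in sequentially. real n * p_max ^ L < 1"
    by (rule order_tendstoD) simp
  then have "\<exists>L. real n * p_max ^ L < 1"
    by (auto simp: eventually_sequentially)
  then have "real n * p_max ^ threshold_level n < 1"
    unfolding threshold_level_def by (rule someI_ex)
  moreover have "real n * p_max ^ L \<le> real n * p_max ^ threshold_level n"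
    using L p_max_pos p_max_less_1 by (intro mult_left_mono power_decreasing) auto
  ultimately show ?thesis by simp
qed

definition linear_part :: "nat \<Rightarrow> 'a \<Rightarrow> real" where
  "linear_part n \<omega> = (\<Sum>j<n. level_tau n (prefixes (threshold_level n) n \<omega> j))"

text \<open>Symbols after the crossing do not change \<open>level_tau n\<close>, so one random
  variable serves as the linear part for all large \<open>L\<close>, while only the truncated count
  still depends on \<open>L\<close>.\<close>

lemma linear_part_eq:
  assumes "threshold_level n \<le> L"
  shows "linear_part n \<omega> = (\<Sum>j<n. level_tau n (prefixes L n \<omega> j))"
  unfolding linear_part_def
proof (rule sum.cong[OF refl])
  fix j assume "j \<in> {..<n}"
  then have j: "j < n" by simp
  have "level_tau n (prefixes L n \<omega> j) = level_tau n (take (Suc (threshold_level n)) (prefixes L n \<omega> j))"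
    using j assms by (intro level_tau_take threshold_level) (auto simp: prefixes_def)
  also have "take (Suc (threshold_level n)) (prefixes L n \<omega> j) = prefixes (threshold_level n) n \<omega> j"
    using j assms unfolding prefixes_def by (simp add: take_map take_upt del: upt_Suc)
  finally show "level_tau n (prefixes (threshold_level n) n \<omega> j) = level_tau n (prefixes L n \<omega> j)" ..
qed

lemma remainder_prefixes:
  assumes "threshold_level n \<le> L"
  shows "remainder L n {..<n} (prefixes L n \<omega>) = truncated_ops (\<lambda>j i. X j i \<omega>) n L - linear_part n \<omega>"
  unfolding remainder_def truncated_ops_prefixes linear_part_eq[OF assms] ..

end

context random_trie
begin

section \<open>Removal of the truncation\<close>

abbreviation ops :: "nat \<Rightarrow> 'a \<Rightarrow> real" where
  "ops n \<omega> \<equiv> real (bucket_ops (\<lambda>j i. X j i \<omega>) n)"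

abbreviation trunc :: "nat \<Rightarrow> nat \<Rightarrow> 'a \<Rightarrow> real" where
  "trunc n L \<omega> \<equiv> truncated_ops (\<lambda>j i. X j i \<omega>) n L"

lemma ops_measurable [measurable]: "ops n \<in> borel_measurable M"
proof -
  have [measurable]: "(\<lambda>\<omega>. trie_depth (\<lambda>j i. X j i \<omega>) n j) \<in> measurable M (count_space UNIV)" for j
    unfolding trie_depth_def by measurable
  show ?thesis unfolding bucket_ops_def of_nat_sum by measurable
qed

lemma integrable_trunc_fun:
  fixes g :: "real \<Rightarrow> real"
  shows "integrable M (\<lambda>\<omega>. g (trunc n L \<omega>))"
  unfolding truncated_ops_prefixes
  by (rule prefixes_transfer(1)[where f = "\<lambda>x. g (\<Sum>j<n. depth L {..<n} x j)"])

lemma integrable_linear_part_fun: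
  fixes g :: "real \<Rightarrow> 'b :: {banach, second_countable_topology}"
  shows "integrable M (\<lambda>\<omega>. g (linear_part n \<omega>))"
    and "integral\<^sup>L M (\<lambda>\<omega>. g (linear_part n \<omega>))
      = integral\<^sup>L (measure_pmf (sources (threshold_level n) {..<n})) (\<lambda>x. g (\<Sum>j<n. level_tau n (x j)))"
  unfolding linear_part_def
  by (rule prefixes_transfer[where f = "\<lambda>x. g (\<Sum>j<n. level_tau n (x j))"])+

lemma trunc_measurable [measurable]: "trunc n L \<in> borel_measurable M"
  using integrable_trunc_fun[of "\<lambda>x. x"] by (rule borel_measurable_integrable)

lemma linear_part_measurable [measurable]: "linear_part n \<in> borel_measurable M"
  using integrable_linear_part_fun(1)[of "\<lambda>x. x"] by (rule borel_measurable_integrable)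

lemma integrable_linear_part: "integrable M (linear_part n)" "integrable M (\<lambda>\<omega>. (linear_part n \<omega>)\<^sup>2)"
  using integrable_linear_part_fun(1)[of "\<lambda>x. x" n] integrable_linear_part_fun(1)[of "\<lambda>x. x\<^sup>2" n] by auto

lemma linear_part_moments:
  shows "expectation (linear_part n) = n * measure_pmf.expectation (source (threshold_level n)) (level_tau n)"
    and "variance (linear_part n) = n * measure_pmf.variance (source (threshold_level n)) (level_tau n)"
proof -
  note mom = Pi_pmf_sum_moments[OF finite_set_source finite_lessThan, of n "[]" "threshold_level n" "level_tau n",
      folded sources_def]
  show E: "expectation (linear_part n) = n * measure_pmf.expectation (source (threshold_level n)) (level_tau n)"
    using integrable_linear_part_fun(2)[of "\<lambda>x. x" n] mom(1) by simp
  show "variance (linear_part n) = n * measure_pmf.variance (source (threshold_level n)) (level_tau n)"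
    using integrable_linear_part_fun(2)[of "\<lambda>x. (x - expectation (linear_part n))\<^sup>2" n] mom E by simp
qed

definition rest :: "nat \<Rightarrow> nat \<Rightarrow> 'a \<Rightarrow> real" where
  "rest n L \<omega> = trunc n L \<omega> - linear_part n \<omega>"

lemma rest_fun:
  fixes g :: "real \<Rightarrow> real"
  assumes "threshold_level n \<le> L"
  shows "integrable M (\<lambda>\<omega>. g (rest n L \<omega>))"
    and "expectation (\<lambda>\<omega>. g (rest n L \<omega>)) = measure_pmf.expectation (sources L {..<n}) (\<lambda>x. g (remainder L n {..<n} x))"
  unfolding rest_def remainder_prefixes[OF assms, symmetric]
  by (rule prefixes_transfer[where f = "\<lambda>x. g (remainder L n {..<n} x)"])+

lemma rest_moments:
  assumes n: "2 \<le> n" and L: "threshold_level n \<le> L"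
  shows "\<bar>expectation (rest n L)\<bar> \<le> n * (1 + defect_const)"
    and "variance (rest n L) \<le> n * defect_const"
proof -
  have E: "expectation (rest n L) = measure_pmf.expectation (sources L {..<n}) (remainder L n {..<n})"
    using rest_fun(2)[OF L, of "\<lambda>x. x"] by simp
  show "\<bar>expectation (rest n L)\<bar> \<le> n * (1 + defect_const)"
    unfolding E using expectation_remainder[of "{..<n}" L] n by simp
  have "variance (rest n L) = measure_pmf.variance (sources L {..<n}) (remainder L n {..<n})"
    using rest_fun(2)[OF L, of "\<lambda>x. (x - expectation (rest n L))\<^sup>2"] unfolding E by simp
  then show "variance (rest n L) \<le> n * defect_const"
    using variance_remainder[of "{..<n}" L] n by simp
qed

text \<open>The truncated count increases with \<open>L\<close>, so it may be replaced by the one at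
  a level beyond \<open>threshold_level n\<close>; there it is the linear part plus a remainder
  whose moments are bounded independently of \<open>L\<close>.\<close>

lemma trunc_square_bounded:
  assumes n: "2 \<le> n"
  shows "\<exists>K. \<forall>L. expectation (\<lambda>\<omega>. (trunc n L \<omega>)\<^sup>2) \<le> K"
proof (intro exI allI)
  fix L
  define L' where "L' = max L (threshold_level n)"
  have L': "threshold_level n \<le> L'" "L \<le> L'" by (auto simp: L'_def)
  have int: "integrable M (rest n L')" "integrable M (\<lambda>\<omega>. (rest n L' \<omega>)\<^sup>2)"
    using rest_fun(1)[OF L'(1), of "\<lambda>x. x"] rest_fun(1)[OF L'(1), of "\<lambda>x. x\<^sup>2"] by simp_all
  have "(trunc n L \<omega>)\<^sup>2 \<le> 2 * (rest n L' \<omega>)\<^sup>2 + 2 * (linear_part n \<omega>)\<^sup>2" for \<omega>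
  proof -
    have "(trunc n L \<omega>)\<^sup>2 \<le> (trunc n L' \<omega>)\<^sup>2"
      using L' by (intro power_mono truncated_ops_mono truncated_ops_nonneg)
    also have "\<dots> = (rest n L' \<omega> + linear_part n \<omega>)\<^sup>2" by (simp add: rest_def)
    also have "(a + b)\<^sup>2 \<le> 2 * a\<^sup>2 + 2 * b\<^sup>2" for a b :: real
      using zero_le_power2[of "a - b"] by (simp add: power2_sum power2_diff)
    finally show ?thesis .
  qed
  then have "expectation (\<lambda>\<omega>. (trunc n L \<omega>)\<^sup>2) \<le> expectation (\<lambda>\<omega>. 2 * (rest n L' \<omega>)\<^sup>2 + 2 * (linear_part n \<omega>)\<^sup>2)"
    using integrable_trunc_fun[of "\<lambda>x. x\<^sup>2" n L] int integrable_linear_part by (intro integral_mono) auto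
  also have "\<dots> = 2 * (variance (rest n L') + (expectation (rest n L'))\<^sup>2) + 2 * expectation (\<lambda>\<omega>. (linear_part n \<omega>)\<^sup>2)"
    using int integrable_linear_part by (simp add: variance_eq)
  also have "\<dots> \<le> 2 * (n * defect_const + (n * (1 + defect_const))\<^sup>2) + 2 * expectation (\<lambda>\<omega>. (linear_part n \<omega>)\<^sup>2)"
  proof -
    have "(expectation (rest n L'))\<^sup>2 \<le> (n * (1 + defect_const))\<^sup>2"
      using rest_moments(1)[OF n L'(1)] by (metis abs_ge_zero power2_abs power_mono)
    with rest_moments(2)[OF n L'(1)] show ?thesis
      by (intro add_right_mono mult_left_mono add_mono) auto
  qed
  finally show "expectation (\<lambda>\<omega>. (trunc n L \<omega>)\<^sup>2)
    \<le> 2 * (n * defect_const + (n * (1 + defect_const))\<^sup>2) + 2 * expectation (\<lambda>\<omega>. (linear_part n \<omega>)\<^sup>2)" .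
qed

text \<open>On the event that the two strings are equal the truncated count is at least
  \<open>L\<close>, so \<open>L^2\<close> times its probability stays below the uniform bound
  \<open>K\<close> for every \<open>L\<close>.\<close>

lemma AE_distinct_strings:
  assumes n: "2 \<le> n" and jl: "j < n" "l < n" "l \<noteq> j"
  shows "AE \<omega> in M. \<exists>i. X l i \<omega> \<noteq> X j i \<omega>"
proof -
  define N where "N = {\<omega> \<in> space M. \<forall>i. X l i \<omega> = X j i \<omega>}"
  have [measurable]: "N \<in> sets M" unfolding N_def by measurable
  obtain K where K: "\<And>L. expectation (\<lambda>\<omega>. (trunc n L \<omega>)\<^sup>2) \<le> K"
    using trunc_square_bounded[OF n] by auto
  have bound: "(real L)\<^sup>2 * prob N \<le> K" for L
  proof -
    have "(real L)\<^sup>2 * prob N = expectation (\<lambda>\<omega>. (real L)\<^sup>2 * indicator N \<omega>)"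
      by simp
    also have "\<dots> \<le> expectation (\<lambda>\<omega>. (trunc n L \<omega>)\<^sup>2)"
    proof (rule integral_mono)
      show "integrable M (\<lambda>\<omega>. (trunc n L \<omega>)\<^sup>2)" by (rule integrable_trunc_fun)
      fix \<omega> assume "\<omega> \<in> space M"
      show "(real L)\<^sup>2 * indicator N \<omega> \<le> (trunc n L \<omega>)\<^sup>2"
      proof (cases "\<omega> \<in> N")
        case True
        then have "real L \<le> trunc n L \<omega>"
          using jl by (intro truncated_ops_equal_strings[of j n l]) (auto simp: N_def)
        with True show ?thesis by (simp add: power_mono)
      qed simp
    qed (auto simp: less_top[symmetric])
    finally show ?thesis using K[of L] by linarith
  qed
  have "prob N = 0"
  proof (rule ccontr)
    assume "prob N \<noteq> 0"
    then have pos: "0 < prob N" by (simp add: zero_less_measure_iff)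
    obtain L :: nat where L: "K / prob N < real L" "1 \<le> real L"
      using reals_Archimedean2[of "max (K / prob N) 1"] by auto
    have "real L \<le> (real L)\<^sup>2" using L(2) by (simp add: power2_eq_square)
    then have "K / prob N < (real L)\<^sup>2" using L(1) by linarith
    then have "K < (real L)\<^sup>2 * prob N" using pos by (simp add: pos_divide_less_eq)
    with bound[of L] show False by simp
  qed
  then have "AE \<omega> in M. \<omega> \<notin> N"
    by (subst (asm) prob_eq_0) auto
  with AE_space show ?thesis by eventually_elim (auto simp: N_def)
qed

lemma AE_trunc_eventually:
  assumes n: "2 \<le> n"
  shows "AE \<omega> in M. \<forall>\<^sub>F L in sequentially. trunc n L \<omega> = ops n \<omega> - real n"
proof -
  have "AE \<omega> in M. \<forall>j\<in>{..<n}. \<forall>l\<in>{..<n}. l \<noteq> j \<longrightarrow> (\<exists>i. X l i \<omega> \<noteq> X j i \<omega>)"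
    using AE_distinct_strings[OF n] by (intro AE_finite_allI) auto
  then show ?thesis
    by eventually_elim (intro truncated_ops_eventually[OF n], auto)
qed

lemma ops_square_integrable:
  assumes n: "2 \<le> n"
  shows "integrable M (\<lambda>\<omega>. (ops n \<omega> - real n)\<^sup>2)"
proof -
  obtain K where K: "\<And>L. expectation (\<lambda>\<omega>. (trunc n L \<omega>)\<^sup>2) \<le> K"
    using trunc_square_bounded[OF n] by auto
  have U: "(\<lambda>\<omega>. ops n \<omega> - real n) \<in> borel_measurable M" by measurable
  show ?thesis
    by (rule monotone_square_limit[of "\<lambda>\<omega>. ops n \<omega> - real n" "trunc n" K, OF U integrable_trunc_fun
          truncated_ops_nonneg truncated_ops_mono K AE_trunc_eventually[OF n]])
qed

text \<open>Almost surely \<open>rest n L\<close> eventually equals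
  \<open>ops n - n - linear_part n\<close>, where \<open>n\<close> is the root level. The bounds for
  \<open>rest n L\<close> are uniform in \<open>L\<close> and pass to this limit; adding
  \<open>n\<close> back does not change the variance.\<close>

lemma ops_decomposition:
  assumes n: "2 \<le> n"
  shows "integrable M (\<lambda>\<omega>. (ops n \<omega>)\<^sup>2)"
    and "\<bar>expectation (ops n) - n - expectation (linear_part n)\<bar> \<le> n * (1 + defect_const)"
    and "variance (\<lambda>\<omega>. ops n \<omega> - linear_part n \<omega>) \<le> n * defect_const"
proof -
  define U where "U \<omega> = ops n \<omega> - real n" for \<omega>
  define Q where "Q \<omega> = U \<omega> - linear_part n \<omega>" for \<omega>
  have U_meas [measurable]: "U \<in> borel_measurable M" unfolding U_def[abs_def] by measurable
  have Q_meas: "Q \<in> borel_measurable M" unfolding Q_def[abs_def] by measurable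
  have rest_meas: "rest n L \<in> borel_measurable M" for L unfolding rest_def[abs_def] by measurable
  have U2: "integrable M (\<lambda>\<omega>. (U \<omega>)\<^sup>2)"
    unfolding U_def by (rule ops_square_integrable[OF n])
  have U1: "integrable M U"
    using square_integrable_imp_integrable[OF U_meas U2] .
  have ops_eq: "ops n = (\<lambda>\<omega>. U \<omega> + real n)"
    by (simp add: U_def fun_eq_iff)
  have "integrable M (\<lambda>\<omega>. (U \<omega> + real n)\<^sup>2)"
    using U1 U2 by (simp add: power2_sum)
  then show "integrable M (\<lambda>\<omega>. (ops n \<omega>)\<^sup>2)"
    by (simp add: U_def)
  \<comment> \<open>The truncated count lies between 0 and its limit \<open>U\<close>, and the
    linear part is nonnegative, so their sum dominates the absolute difference for every
    \<open>L\<close>.\<close>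
  define w where "w \<omega> = U \<omega> + linear_part n \<omega>" for \<omega>
  have w_meas: "w \<in> borel_measurable M" unfolding w_def[abs_def] by measurable
  have w2: "integrable M (\<lambda>\<omega>. (w \<omega>)\<^sup>2)"
    unfolding w_def by (rule integrable_add_square[OF U_meas linear_part_measurable U2 integrable_linear_part(2)])
  have lin0: "0 \<le> linear_part n \<omega>" for \<omega>
    unfolding linear_part_def by (intro sum_nonneg level_tau_nonneg)
  have lim: "AE \<omega> in M. (\<lambda>L. rest n L \<omega>) \<longlonglongrightarrow> Q \<omega>"
    using AE_trunc_eventually[OF n]
  proof eventually_elim
    case (elim \<omega>)
    then have "\<forall>\<^sub>F L in sequentially. rest n L \<omega> = Q \<omega>"
      by (rule eventually_mono) (simp add: rest_def Q_def U_def)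
    then show ?case by (rule tendsto_eventually)
  qed
  have dom: "AE \<omega> in M. \<bar>rest n L \<omega>\<bar> \<le> w \<omega>" for L
    using AE_trunc_eventually[OF n]
  proof eventually_elim
    case (elim \<omega>)
    then obtain L0 where L0: "\<And>L. L0 \<le> L \<Longrightarrow> trunc n L \<omega> = U \<omega>"
      unfolding eventually_sequentially U_def by blast
    have "trunc n L \<omega> \<le> trunc n (max L L0) \<omega>" by (intro truncated_ops_mono) simp
    also have "\<dots> = U \<omega>" by (rule L0) simp
    finally show ?case
      using truncated_ops_nonneg[of "\<lambda>j i. X j i \<omega>" n L] lin0[of \<omega>]
      unfolding rest_def w_def by linarith
  qed
  note Q = variance_limit_le[of Q "rest n" w "threshold_level n", OF Q_meas rest_meas w_meas w2 lim dom
      rest_moments(1)[OF n] rest_moments(2)[OF n]]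
  have "expectation (ops n) - n - expectation (linear_part n) = expectation Q"
    unfolding ops_eq Q_def[abs_def] using U1 integrable_linear_part(1) by (simp add: prob_space)
  with Q(2) show "\<bar>expectation (ops n) - n - expectation (linear_part n)\<bar> \<le> n * (1 + defect_const)"
    by simp
  have Y: "(\<lambda>\<omega>. ops n \<omega> - linear_part n \<omega>) = (\<lambda>\<omega>. Q \<omega> + real n)"
    by (simp add: Q_def U_def fun_eq_iff)
  have "expectation (\<lambda>\<omega>. Q \<omega> + real n) = expectation Q + real n"
    using Q(1) by (simp add: prob_space)
  then have "variance (\<lambda>\<omega>. Q \<omega> + real n) = variance Q" by simp
  moreover have "variance (\<lambda>\<omega>. ops n \<omega> - linear_part n \<omega>) = variance (\<lambda>\<omega>. Q \<omega> + real n)"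
    by (rule arg_cong[OF Y])
  ultimately show "variance (\<lambda>\<omega>. ops n \<omega> - linear_part n \<omega>) \<le> n * defect_const"
    using Q(3) by simp
qed

end

section \<open>Asymptotics\<close>

lemma tendsto_ratio_of_bigo:
  fixes v :: "nat \<Rightarrow> real"
  assumes v: "\<And>n. 3 \<le> n \<Longrightarrow> \<bar>v n - s * n * ln n\<bar> \<le> C * n * sqrt (ln n)"
  shows "(\<lambda>n. v n / (n * ln n)) \<longlonglongrightarrow> s"
proof -
  have "(\<lambda>n. v n / (n * ln n) - s) \<longlonglongrightarrow> 0"
  proof (rule Lim_null_comparison)
    show "\<forall>\<^sub>F n in sequentially. norm (v n / (n * ln n) - s) \<le> C / sqrt (ln (real n))"
      unfolding eventually_sequentially
    proof (intro exI allI impI)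
      fix n :: nat assume n: "3 \<le> n"
      have l: "0 < ln (real n)" using n by simp
      have pos: "0 < real n * ln n" using n l by simp
      have "v n / (n * ln n) - s = (v n - s * n * ln n) / (n * ln n)"
        using n l by (simp add: diff_divide_distrib)
      then have "norm (v n / (n * ln n) - s) = \<bar>v n - s * n * ln n\<bar> / (n * ln n)"
        using pos by simp
      also have "\<dots> \<le> C * n * sqrt (ln n) / (n * ln n)"
        using pos v[OF n] by (intro divide_right_mono) auto
      also have "\<dots> = C * (sqrt (ln n) / ln n)"
        using n by simp
      also have "sqrt (ln n) / ln n = 1 / sqrt (ln n)"
        using l by (simp add: sqrt_divide_self_eq inverse_eq_divide)
      finally show "norm (v n / (n * ln n) - s) \<le> C / sqrt (ln (real n))" by simp
    qed
    show "(\<lambda>n. C / sqrt (ln (real n))) \<longlonglongrightarrow> 0" by real_asymp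
  qed
  then show ?thesis by (simp only: LIM_zero_iff)
qed

section \<open>Comparison of characteristic functions and of normalisations\<close>

lemma norm_iexp_diff_le: "cmod (iexp a - iexp b) \<le> \<bar>a - b\<bar>"
proof -
  have "iexp a - iexp b = iexp b * (iexp (a - b) - 1)"
    by (simp add: right_diff_distrib flip: exp_add)
  then have "cmod (iexp a - iexp b) = cmod (iexp (a - b) - 1)"
    by (simp add: norm_mult)
  also have "\<dots> \<le> \<bar>a - b\<bar>" using iexp_approx1[of "a - b" 0] by simp
  finally show ?thesis .
qed

context prob_space
begin

lemma char_distr_diff_le:
  assumes [measurable]: "U \<in> borel_measurable M" "W \<in> borel_measurable M"
    and int: "integrable M (\<lambda>x. \<bar>U x - W x\<bar>)"
  shows "cmod (char (distr M borel U) \<theta> - char (distr M borel W) \<theta>) \<le> \<bar>\<theta>\<bar> * expectation (\<lambda>x. \<bar>U x - W x\<bar>)"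
proof -
  have i: "integrable M (\<lambda>x. iexp (\<theta> * Z x))" if [measurable]: "Z \<in> borel_measurable M" for Z
    by (rule integrable_const_bound[of _ 1]) auto
  have "char (distr M borel U) \<theta> - char (distr M borel W) \<theta> = (CLINT x|M. iexp (\<theta> * U x) - iexp (\<theta> * W x))"
  proof -
    have "char (distr M borel Z) \<theta> = (CLINT x|M. iexp (\<theta> * Z x))" if "Z \<in> borel_measurable M" for Z
      unfolding char_def using that by (subst integral_distr) auto
    then show ?thesis
      using Bochner_Integration.integral_diff[OF i i, of U W] assms(1,2) by (simp only:)
  qed
  also have "cmod \<dots> \<le> expectation (\<lambda>x. cmod (iexp (\<theta> * U x) - iexp (\<theta> * W x)))"
    by (rule integral_norm_bound)
  also have "\<dots> \<le> expectation (\<lambda>x. \<bar>\<theta>\<bar> * \<bar>U x - W x\<bar>)"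
  proof (rule integral_mono)
    show "integrable M (\<lambda>x. cmod (iexp (\<theta> * U x) - iexp (\<theta> * W x)))"
      by (intro integrable_norm Bochner_Integration.integrable_diff i) auto
    show "cmod (iexp (\<theta> * U x) - iexp (\<theta> * W x)) \<le> \<bar>\<theta>\<bar> * \<bar>U x - W x\<bar>" for x
      using norm_iexp_diff_le[of "\<theta> * U x" "\<theta> * W x"] by (simp add: abs_mult flip: right_diff_distrib)
  qed (use int in auto)
  finally show ?thesis by simp
qed

text \<open>The difference is the centred \<open>Y - X\<close> divided by \<open>sqrt v\<close>,
  plus the centred \<open>X\<close> times the change of scale
  \<open>1 / sqrt v - 1 / sqrt a\<close>; each mean absolute value is bounded by the corresponding
  standard deviation.\<close>

lemma normalization_diff_le:
  fixes X Y :: "'a \<Rightarrow> real"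
  defines "a \<equiv> variance X" and "v \<equiv> variance Y"
  assumes [measurable]: "X \<in> borel_measurable M" "Y \<in> borel_measurable M"
    and X2: "integrable M (\<lambda>x. (X x)\<^sup>2)" and Y2: "integrable M (\<lambda>x. (Y x)\<^sup>2)"
    and pos: "0 < a" "0 < v"
  shows "integrable M (\<lambda>x. \<bar>(Y x - expectation Y) / sqrt v - (X x - expectation X) / sqrt a\<bar>)"
    and "expectation (\<lambda>x. \<bar>(Y x - expectation Y) / sqrt v - (X x - expectation X) / sqrt a\<bar>)
      \<le> sqrt (variance (\<lambda>x. Y x - X x) / v) + \<bar>sqrt (a / v) - 1\<bar>"
proof -
  have iX: "integrable M X" and iY: "integrable M Y"
    using square_integrable_imp_integrable[of X] square_integrable_imp_integrable[of Y] X2 Y2 by auto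
  define Z where "Z x = Y x - X x" for x
  have [measurable]: "Z \<in> borel_measurable M" unfolding Z_def by measurable
  have iZ: "integrable M Z" unfolding Z_def using iX iY by auto
  have Z2: "integrable M (\<lambda>x. (Z x)\<^sup>2)"
    unfolding Z_def using integrable_add_square[of Y M "\<lambda>x. - X x"] X2 Y2 by simp
  have cX: "integrable M (\<lambda>x. (X x - expectation X)\<^sup>2)" and cZ: "integrable M (\<lambda>x. (Z x - expectation Z)\<^sup>2)"
    using X2 Z2 iX iZ by (auto simp: power2_diff)
  show int: "integrable M (\<lambda>x. \<bar>(Y x - expectation Y) / sqrt v - (X x - expectation X) / sqrt a\<bar>)"
    using iX iY by auto
  define r where "r = \<bar>1 / sqrt v - 1 / sqrt a\<bar>"
  have pt: "\<bar>(Y x - expectation Y) / sqrt v - (X x - expectation X) / sqrt a\<bar>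
    \<le> \<bar>Z x - expectation Z\<bar> / sqrt v + r * \<bar>X x - expectation X\<bar>" for x
  proof -
    have EZ: "expectation Z = expectation Y - expectation X"
      unfolding Z_def using iX iY by simp
    have "(Y x - expectation Y) / sqrt v - (X x - expectation X) / sqrt a
      = (Z x - expectation Z) / sqrt v + (1 / sqrt v - 1 / sqrt a) * (X x - expectation X)"
      unfolding EZ Z_def by (simp add: divide_inverse algebra_simps)
    also have "\<bar>\<dots>\<bar> \<le> \<bar>(Z x - expectation Z) / sqrt v\<bar> + \<bar>(1 / sqrt v - 1 / sqrt a) * (X x - expectation X)\<bar>"
      by (rule abs_triangle_ineq)
    finally show ?thesis using pos by (simp add: r_def abs_mult abs_divide)
  qed
  have "expectation (\<lambda>x. \<bar>(Y x - expectation Y) / sqrt v - (X x - expectation X) / sqrt a\<bar>)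
    \<le> expectation (\<lambda>x. \<bar>Z x - expectation Z\<bar> / sqrt v + r * \<bar>X x - expectation X\<bar>)"
    using pt int iX iZ by (intro integral_mono) auto
  also have "\<dots> = expectation (\<lambda>x. \<bar>Z x - expectation Z\<bar>) / sqrt v + r * expectation (\<lambda>x. \<bar>X x - expectation X\<bar>)"
    using iX iZ by simp
  also have "\<dots> \<le> sqrt (variance Z) / sqrt v + r * sqrt a"
  proof -
    have "expectation (\<lambda>x. \<bar>Z x - expectation Z\<bar>) \<le> sqrt (variance Z)"
      using cZ by (intro abs_expectation_le_sqrt) auto
    moreover have "expectation (\<lambda>x. \<bar>X x - expectation X\<bar>) \<le> sqrt a"
      unfolding a_def using cX by (intro abs_expectation_le_sqrt) auto
    ultimately show ?thesis
      using pos by (intro add_mono divide_right_mono mult_left_mono) (auto simp: r_def)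
  qed
  also have "r * sqrt a = \<bar>sqrt (a / v) - 1\<bar>"
  proof -
    have "r * sqrt a = \<bar>(1 / sqrt v - 1 / sqrt a) * sqrt a\<bar>"
      using pos by (simp add: r_def abs_mult)
    also have "(1 / sqrt v - 1 / sqrt a) * sqrt a = sqrt (a / v) - 1"
      using pos by (simp add: left_diff_distrib real_sqrt_divide)
    finally show ?thesis .
  qed
  finally show "expectation (\<lambda>x. \<bar>(Y x - expectation Y) / sqrt v - (X x - expectation X) / sqrt a\<bar>)
      \<le> sqrt (variance (\<lambda>x. Y x - X x) / v) + \<bar>sqrt (a / v) - 1\<bar>"
    by (simp add: real_sqrt_divide Z_def[abs_def])
qed

end

text \<open>\<open>3\<close> exceeds Euler's number. From \<open>n = 3\<close> on, additive
  constants can be absorbed into multiples of \<open>sqrt (ln n)\<close>.\<close>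

lemma one_le_ln: "3 \<le> n \<Longrightarrow> 1 \<le> ln (real n)"
  using exp_le by (subst ln_ge_iff) auto

context random_trie
begin

section \<open>Moments and limit law of the number of bucket operations\<close>

lemma defect_const_nonneg: "0 \<le> defect_const"
  unfolding defect_const_def using \<mu>_min_pos by simp

lemma mart_const_nonneg: "0 \<le> mart_const"
  by (simp add: mart_const_def)

lemma p_min_le_1: "p_min \<le> 1"
  using p_min_le[of True True] p_less_1[of True True] by linarith

lemma expectation_ops:
  assumes n: "2 \<le> n"
  shows "\<bar>expectation (ops n) - n * ln n / H\<bar> \<le> (2 + defect_const + tau_const) * n"
proof -
  let ?m = "measure_pmf.expectation (source (threshold_level n)) (level_tau n)"
  have "\<bar>?m - ln n / H\<bar> \<le> tau_const"
    using n p_min_le_1 by (intro expectation_level_tau threshold_level) auto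
  then have "n * \<bar>?m - ln n / H\<bar> \<le> n * tau_const" by (intro mult_left_mono) auto
  then have "\<bar>n * (?m - ln n / H)\<bar> \<le> n * tau_const" by (simp only: abs_mult abs_of_nat)
  then have "\<bar>expectation (linear_part n) - n * ln n / H\<bar> \<le> n * tau_const"
    by (simp add: linear_part_moments(1) right_diff_distrib)
  \<comment> \<open>The \<open>2\<close> collects the root level and the summand 1 in the bound for
    the mean of the remainder.\<close>
  moreover have "(2 + defect_const + tau_const) * n = n + n * (1 + defect_const) + n * tau_const"
    by (simp add: algebra_simps)
  ultimately show ?thesis
    using ops_decomposition(2)[OF n] by linarith
qed

definition linear_var_const :: real where
  "linear_var_const = mart_const + 2 * sqrt ((\<bar>sigma2 p\<bar> + mart_const) * tau_const\<^sup>2) + tau_const\<^sup>2"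

lemma linear_var_const_nonneg: "0 \<le> linear_var_const"
  unfolding linear_var_const_def using mart_const_nonneg by simp

lemma variance_linear_part:
  assumes n: "3 \<le> n"
  shows "\<bar>variance (linear_part n) - sigma2 p * n * ln n\<bar> \<le> linear_var_const * n * sqrt (ln n)"
proof -
  let ?v = "measure_pmf.variance (source (threshold_level n)) (level_tau n)"
  define l where "l = ln (real n)"
  have l: "1 \<le> l" using one_le_ln[OF n] by (simp add: l_def)
  then have sl: "1 \<le> sqrt l" by simp
  have "\<bar>?v - sigma2 p * l\<bar> \<le> mart_const + 2 * sqrt ((sigma2 p * l + mart_const) * tau_const\<^sup>2) + tau_const\<^sup>2"
    unfolding l_def using n by (intro variance_level_tau threshold_level) auto
  also have "\<dots> \<le> mart_const * sqrt l + 2 * (sqrt ((\<bar>sigma2 p\<bar> + mart_const) * tau_const\<^sup>2) * sqrt l) + tau_const\<^sup>2 * sqrt l"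
  proof -
    have "sigma2 p * l + mart_const \<le> \<bar>sigma2 p\<bar> * l + mart_const * l"
      using l mart_const_nonneg by (intro add_mono mult_right_mono mult_left_le[THEN order_trans]) (auto simp: mult_le_cancel_left1)
    then have "(sigma2 p * l + mart_const) * tau_const\<^sup>2 \<le> (\<bar>sigma2 p\<bar> * l + mart_const * l) * tau_const\<^sup>2"
      by (intro mult_right_mono) auto
    also have "\<dots> = (\<bar>sigma2 p\<bar> + mart_const) * tau_const\<^sup>2 * l" by (simp add: algebra_simps)
    finally have "sqrt ((sigma2 p * l + mart_const) * tau_const\<^sup>2) \<le> sqrt ((\<bar>sigma2 p\<bar> + mart_const) * tau_const\<^sup>2) * sqrt l"
      by (simp only: real_sqrt_mult[symmetric] real_sqrt_le_iff)
    moreover have "mart_const * 1 \<le> mart_const * sqrt l" "tau_const\<^sup>2 * 1 \<le> tau_const\<^sup>2 * sqrt l"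
      using sl mart_const_nonneg by (intro mult_left_mono; simp)+
    ultimately show ?thesis by linarith
  qed
  also have "\<dots> = linear_var_const * sqrt l"
    unfolding linear_var_const_def by (simp add: distrib_right)
  finally have "n * \<bar>?v - sigma2 p * l\<bar> \<le> n * (linear_var_const * sqrt l)"
    by (intro mult_left_mono) auto
  then have "\<bar>n * (?v - sigma2 p * l)\<bar> \<le> n * (linear_var_const * sqrt l)"
    by (simp only: abs_mult abs_of_nat)
  then show ?thesis
    unfolding linear_part_moments(2) l_def[symmetric] by (simp only: right_diff_distrib mult_ac)
qed

definition ops_var_const :: real where
  "ops_var_const = linear_var_const + 2 * sqrt ((\<bar>sigma2 p\<bar> + linear_var_const) * defect_const) + defect_const"

lemma variance_ops:
  assumes n: "3 \<le> n"
  shows "\<bar>variance (ops n) - sigma2 p * n * ln n\<bar> \<le> ops_var_const * n * sqrt (ln n)"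
proof -
  define l where "l = ln (real n)"
  define VA where "VA = variance (linear_part n)"
  have n2: "2 \<le> n" using n by simp
  have l: "1 \<le> l" using one_le_ln[OF n] by (simp add: l_def)
  then have sl: "1 \<le> sqrt l" "sqrt l \<le> l"
    using real_sqrt_le_mono[of l "l * l"] by (auto simp: mult_le_cancel_left1)
  let ?Y = "\<lambda>\<omega>. ops n \<omega> - linear_part n \<omega>"
  have Y2: "integrable M (\<lambda>\<omega>. (?Y \<omega>)\<^sup>2)"
    using integrable_add_square[of "ops n" M "\<lambda>\<omega>. - linear_part n \<omega>"] ops_decomposition(1)[OF n2] integrable_linear_part by simp
  have "\<bar>variance (\<lambda>\<omega>. linear_part n \<omega> + ?Y \<omega>) - VA\<bar> \<le> 2 * sqrt (VA * variance ?Y) + variance ?Y"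
    unfolding VA_def using integrable_linear_part Y2 by (intro variance_add_bound) auto
  moreover have VA: "\<bar>VA - sigma2 p * n * l\<bar> \<le> linear_var_const * n * sqrt l"
    unfolding VA_def l_def by (rule variance_linear_part[OF n])
  moreover have Y: "variance ?Y \<le> n * defect_const"
    by (rule ops_decomposition(3)[OF n2])
  \<comment> \<open>Factors of order \<open>n * l\<close> and \<open>n\<close> have a geometric mean
    of order \<open>n * sqrt l\<close>, the order of the claimed error.\<close>
  moreover have "sqrt (VA * variance ?Y) \<le> sqrt ((\<bar>sigma2 p\<bar> + linear_var_const) * defect_const) * (n * sqrt l)"
  proof -
    have "sigma2 p * n * l \<le> \<bar>sigma2 p\<bar> * (n * l)"
      using l by (simp add: mult_right_mono mult.assoc)
    moreover have "linear_var_const * n * sqrt l \<le> linear_var_const * (n * l)"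
      using sl linear_var_const_nonneg by (simp add: mult_left_mono mult.assoc)
    ultimately have "VA \<le> \<bar>sigma2 p\<bar> * (n * l) + linear_var_const * (n * l)"
      using VA by linarith
    then have "VA * variance ?Y \<le> (\<bar>sigma2 p\<bar> * (n * l) + linear_var_const * (n * l)) * (n * defect_const)"
      using Y l linear_var_const_nonneg by (intro mult_mono) (auto intro: variance_positive add_nonneg_nonneg)
    also have "\<dots> = ((\<bar>sigma2 p\<bar> + linear_var_const) * defect_const) * ((n * sqrt l) * (n * sqrt l))"
      using l by (simp add: algebra_simps)
    finally have "sqrt (VA * variance ?Y) \<le> sqrt (((\<bar>sigma2 p\<bar> + linear_var_const) * defect_const) * ((n * sqrt l) * (n * sqrt l)))"
      by (rule real_sqrt_le_mono)
    also have "\<dots> = sqrt ((\<bar>sigma2 p\<bar> + linear_var_const) * defect_const) * (n * sqrt l)"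
      using l by (subst real_sqrt_mult) simp
    finally show ?thesis .
  qed
  moreover have "n * defect_const \<le> defect_const * n * sqrt l"
  proof -
    have "(n * defect_const) * 1 \<le> (n * defect_const) * sqrt l"
      using sl defect_const_nonneg by (intro mult_left_mono) auto
    then show ?thesis by (simp add: mult.commute)
  qed
  moreover have "ops_var_const * n * sqrt l = linear_var_const * n * sqrt l
    + 2 * (sqrt ((\<bar>sigma2 p\<bar> + linear_var_const) * defect_const) * (n * sqrt l)) + defect_const * n * sqrt l"
    unfolding ops_var_const_def by (simp add: algebra_simps)
  ultimately have "\<bar>variance (\<lambda>\<omega>. linear_part n \<omega> + ?Y \<omega>) - sigma2 p * n * l\<bar> \<le> ops_var_const * n * sqrt l"
    by linarith
  then show ?thesis unfolding l_def by simp
qed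

lemma char_linear_part:
  assumes n: "3 \<le> n" "\<theta>\<^sup>2 \<le> 4 * n" and pos: "0 < variance (linear_part n)"
  shows "cmod (char (distr M borel (\<lambda>\<omega>. (linear_part n \<omega> - expectation (linear_part n)) / sqrt (variance (linear_part n)))) \<theta>
      - of_real ((1 + (- \<theta>\<^sup>2 / 2) / n) ^ n))
    \<le> \<bar>\<theta>\<bar> ^ 3 / 6 * ((1 + ln n / (- ln p_max)) / sqrt (variance (linear_part n)))"
proof -
  define L where "L = threshold_level n"
  define b where "b = 1 + ln (real n) / (- ln p_max)"
  let ?m = "measure_pmf.expectation (source L) (level_tau n)"
  let ?v = "measure_pmf.variance (source L) (level_tau n)"
  have mom: "expectation (linear_part n) = n * ?m" "variance (linear_part n) = n * ?v"
    using linear_part_moments unfolding L_def by auto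
  \<comment> \<open>The values and hence their mean lie between 0 and \<open>b\<close>, so
    \<open>b\<close> also bounds the deviations from the mean.\<close>
  have range: "0 \<le> level_tau n y" "level_tau n y \<le> b" for y
    using n level_tau_le[of n y] by (auto simp: level_tau_nonneg b_def)
  have "0 \<le> ?m" by (simp add: range)
  moreover have "?m \<le> measure_pmf.expectation (source L) (\<lambda>_. b)"
    using range by (intro expectation_pmf_mono) auto
  ultimately have m: "0 \<le> ?m" "?m \<le> b" by simp_all
  have "char (distr M borel (\<lambda>\<omega>. (linear_part n \<omega> - n * ?m) / sqrt (n * ?v))) \<theta>
    = (CLINT \<omega>|M. iexp (\<theta> * ((linear_part n \<omega> - n * ?m) / sqrt (n * ?v))))"
    unfolding char_def by (subst integral_distr) auto
  also have "\<dots> = (CLINT x|measure_pmf (sources L {..<n}). iexp (\<theta> * (((\<Sum>j<n. level_tau n (x j)) - n * ?m) / sqrt (n * ?v))))"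
    unfolding L_def by (rule integrable_linear_part_fun(2))
  also have "\<dots> = char (distr (measure_pmf (sources L {..<n})) borel (\<lambda>x. ((\<Sum>j<n. level_tau n (x j)) - n * ?m) / sqrt (n * ?v))) \<theta>"
    unfolding char_def by (subst integral_distr) auto
  finally have char_eq: "char (distr M borel (\<lambda>\<omega>. (linear_part n \<omega> - n * ?m) / sqrt (n * ?v))) \<theta>
    = char (distr (measure_pmf (sources L {..<n})) borel (\<lambda>x. ((\<Sum>j<n. level_tau n (x j)) - n * ?m) / sqrt (n * ?v))) \<theta>" .
  have v: "0 < ?v"
    using pos n unfolding mom(2) by (simp add: zero_less_mult_iff)
  have "\<bar>level_tau n y - ?m\<bar> \<le> b" for y
    using range[of y] m by linarith
  then have "cmod (char (distr (measure_pmf (sources L {..<n})) borel (\<lambda>x. ((\<Sum>j<n. level_tau n (x j)) - n * ?m) / sqrt (n * ?v))) \<theta>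
      - of_real ((1 + (- \<theta>\<^sup>2 / 2) / n) ^ n)) \<le> \<bar>\<theta>\<bar> ^ 3 / 6 * (b / sqrt (n * ?v))"
    unfolding sources_def using n by (intro char_normalized_sum_Pi_pmf finite_set_source v) auto
  then show ?thesis
    unfolding mom(2) unfolding mom(1) b_def[symmetric] char_eq .
qed

text \<open>Levy's continuity theorem with two comparisons: the normalised count with the normalised
  linear part, and the characteristic function of the latter with a power tending to the Gaussian
  one. Positivity of \<open>sigma2 p\<close> gives both variances exact order
  \<open>n * ln n\<close>.\<close>

lemma ops_asymptotic_normality:
  assumes sigma: "0 < sigma2 p"
  shows "weak_conv_m (\<lambda>n. distr M borel (\<lambda>\<omega>. (ops n \<omega> - expectation (ops n)) / sqrt (variance (ops n))))
    std_normal_distribution"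
proof (rule levy_continuity)
  show "real_distribution (distr M borel (\<lambda>\<omega>. (ops n \<omega> - expectation (ops n)) / sqrt (variance (ops n))))" for n
    by (rule real_distribution_distr) measurable
  show "real_distribution std_normal_distribution"
    by (rule real_dist_normal_dist)
  fix \<theta> :: real
  define VA V where "VA n = variance (linear_part n)" and "V n = variance (ops n)" for n
  define \<phi> where "\<phi> n = char (distr M borel (\<lambda>\<omega>. (ops n \<omega> - expectation (ops n)) / sqrt (V n))) \<theta>" for n
  define \<psi> where "\<psi> n = char (distr M borel (\<lambda>\<omega>. (linear_part n \<omega> - expectation (linear_part n)) / sqrt (VA n))) \<theta>" for n
  define e where "e n = complex_of_real ((1 + (- \<theta>\<^sup>2 / 2) / real n) ^ n)" for n
  have limA: "(\<lambda>n. VA n / (n * ln n)) \<longlonglongrightarrow> sigma2 p"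
    unfolding VA_def by (rule tendsto_ratio_of_bigo[OF variance_linear_part])
  have limV: "(\<lambda>n. V n / (n * ln n)) \<longlonglongrightarrow> sigma2 p"
    unfolding V_def by (rule tendsto_ratio_of_bigo[OF variance_ops])
  have ev3: "\<forall>\<^sub>F n in sequentially. 3 \<le> n"
    by (rule eventually_ge_at_top)
  have pos: "\<forall>\<^sub>F n in sequentially. 0 < W n" if "(\<lambda>n. W n / (real n * ln n)) \<longlonglongrightarrow> sigma2 p" for W :: "nat \<Rightarrow> real"
    using order_tendstoD(1)[OF that sigma] ev3
  proof eventually_elim
    case (elim n)
    then have "0 < real n * ln n" by simp
    with elim show ?case by (simp add: zero_less_divide_iff)
  qed
  have evn: "\<forall>\<^sub>F n in sequentially. \<theta>\<^sup>2 \<le> 4 * real n"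
    by real_asymp
  have \<psi>_lim: "(\<lambda>n. \<psi> n - e n) \<longlonglongrightarrow> 0"
  proof (rule Lim_null_comparison)
    define \<delta> where "\<delta> = - ln p_max"
    have "\<delta> > 0" using p_max_pos p_max_less_1 by (simp add: \<delta>_def)
    show "\<forall>\<^sub>F n in sequentially. norm (\<psi> n - e n)
      \<le> \<bar>\<theta>\<bar> ^ 3 / 6 * (((1 + ln n / \<delta>) / sqrt (real n * ln n)) / sqrt (VA n / (real n * ln n)))"
      using ev3 evn pos[OF limA]
    proof eventually_elim
      case (elim n)
      then have eq: "(1 + ln n / \<delta>) / sqrt (real n * ln n) / sqrt (VA n / (real n * ln n)) = (1 + ln n / \<delta>) / sqrt (VA n)"
        by (simp add: real_sqrt_divide)
      show ?case
        unfolding eq unfolding \<psi>_def e_def VA_def \<delta>_def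
        using elim by (intro char_linear_part) (auto simp: VA_def)
    qed
    \<comment> \<open>Summands of size \<open>ln n\<close> are negligible against a standard
      deviation of order \<open>sqrt (n * ln n)\<close>.\<close>
    have "(\<lambda>n. (1 + ln (real n) / \<delta>) / sqrt (real n * ln n)) \<longlonglongrightarrow> 0"
      using \<open>\<delta> > 0\<close> by real_asymp
    then have "(\<lambda>n. ((1 + ln n / \<delta>) / sqrt (real n * ln n)) / sqrt (VA n / (real n * ln n))) \<longlonglongrightarrow> 0 / sqrt (sigma2 p)"
      using sigma by (intro tendsto_divide tendsto_real_sqrt limA) auto
    then show "(\<lambda>n. \<bar>\<theta>\<bar> ^ 3 / 6 * (((1 + ln n / \<delta>) / sqrt (real n * ln n)) / sqrt (VA n / (real n * ln n)))) \<longlonglongrightarrow> 0"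
      by (intro tendsto_mult_right_zero) simp
  qed
  have cancel: "(x / A) / (y / A) = x / y" if "0 < A" for x y A :: real
    using that by simp
  \<comment> \<open>The remainder, of variance \<open>O(n)\<close>, becomes
    \<open>O(1 / sqrt (ln n))\<close> after normalisation, and the two normalising variances have
    the same leading term. Dividing everything by \<open>n * ln n\<close> exposes the known
    limits.\<close>
  have "(\<lambda>n. \<phi> n - \<psi> n) \<longlonglongrightarrow> 0"
  proof (rule Lim_null_comparison)
    show "\<forall>\<^sub>F n in sequentially. norm (\<phi> n - \<psi> n)
      \<le> \<bar>\<theta>\<bar> * (sqrt (defect_const / ln n / (V n / (real n * ln n))) + \<bar>sqrt ((VA n / (real n * ln n)) / (V n / (real n * ln n))) - 1\<bar>)"
      using ev3 pos[OF limA] pos[OF limV]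
    proof eventually_elim
      case (elim n)
      then have n: "2 \<le> n" and l: "0 < real n * ln n" by simp_all
      let ?U = "\<lambda>\<omega>. (ops n \<omega> - expectation (ops n)) / sqrt (V n)"
      let ?W = "\<lambda>\<omega>. (linear_part n \<omega> - expectation (linear_part n)) / sqrt (VA n)"
      note nd = normalization_diff_le[of "linear_part n" "ops n", folded V_def VA_def]
      have int: "integrable M (\<lambda>\<omega>. \<bar>?U \<omega> - ?W \<omega>\<bar>)"
        and le: "expectation (\<lambda>\<omega>. \<bar>?U \<omega> - ?W \<omega>\<bar>)
          \<le> sqrt (variance (\<lambda>\<omega>. ops n \<omega> - linear_part n \<omega>) / V n) + \<bar>sqrt (VA n / V n) - 1\<bar>"
        using nd ops_decomposition(1)[OF n] integrable_linear_part elim by auto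
      have "norm (\<phi> n - \<psi> n) \<le> \<bar>\<theta>\<bar> * expectation (\<lambda>\<omega>. \<bar>?U \<omega> - ?W \<omega>\<bar>)"
        unfolding \<phi>_def \<psi>_def using int by (intro char_distr_diff_le) auto
      also have "\<dots> \<le> \<bar>\<theta>\<bar> * (sqrt (n * defect_const / V n) + \<bar>sqrt (VA n / V n) - 1\<bar>)"
      proof (intro mult_left_mono order_trans[OF le] add_right_mono real_sqrt_le_mono divide_right_mono)
        show "variance (\<lambda>\<omega>. ops n \<omega> - linear_part n \<omega>) \<le> n * defect_const"
          by (rule ops_decomposition(3)[OF n])
      qed (use elim in auto)
      also have "n * defect_const / V n = defect_const / ln n / (V n / (real n * ln n))"
        using elim by simp
      also have "VA n / V n = (VA n / (real n * ln n)) / (V n / (real n * ln n))"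
        by (rule cancel[OF l, symmetric])
      finally show ?case .
    qed
    have "(\<lambda>n. D / ln (real n)) \<longlonglongrightarrow> 0" for D :: real by real_asymp
    then have "(\<lambda>n. \<bar>\<theta>\<bar> * (sqrt (defect_const / ln n / (V n / (real n * ln n))) + \<bar>sqrt ((VA n / (real n * ln n)) / (V n / (real n * ln n))) - 1\<bar>))
      \<longlonglongrightarrow> \<bar>\<theta>\<bar> * (sqrt (0 / sigma2 p) + \<bar>sqrt (sigma2 p / sigma2 p) - 1\<bar>)"
      using sigma by (intro tendsto_intros limA limV) auto
    then show "(\<lambda>n. \<bar>\<theta>\<bar> * (sqrt (defect_const / ln n / (V n / (real n * ln n))) + \<bar>sqrt ((VA n / (real n * ln n)) / (V n / (real n * ln n))) - 1\<bar>)) \<longlonglongrightarrow> 0"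
      using sigma by simp
  qed
  moreover note \<psi>_lim
  moreover have "e \<longlonglongrightarrow> complex_of_real (exp (- \<theta>\<^sup>2 / 2))"
    unfolding e_def by (rule isCont_tendsto_compose [OF _ tendsto_exp_limit_sequentially]) auto
  ultimately have "(\<lambda>n. (\<phi> n - \<psi> n) + ((\<psi> n - e n) + e n)) \<longlonglongrightarrow> 0 + (0 + complex_of_real (exp (- \<theta>\<^sup>2 / 2)))"
    by (intro tendsto_add)
  then show "(\<lambda>n. char (distr M borel (\<lambda>\<omega>. (ops n \<omega> - expectation (ops n)) / sqrt (variance (ops n)))) \<theta>)
    \<longlonglongrightarrow> char std_normal_distribution \<theta>"
    unfolding \<phi>_def V_def by (simp add: char_std_normal_distribution)
qed

end

theorem theorem2p1:
  fixes p :: "bool \<Rightarrow> bool \<Rightarrow> real"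
    and \<mu> :: "bool \<Rightarrow> real"
    and M :: "'a measure"
    and X :: "nat \<Rightarrow> nat \<Rightarrow> 'a \<Rightarrow> bool"
  assumes p_range: "\<And>i j. 0 < p i j \<and> p i j < 1"
    and p_stoch: "\<And>i. p i False + p i True = 1"
    and p_not_half: "\<exists>i j. p i j \<noteq> 1 / 2"
    and mu_nonneg: "\<And>i. 0 \<le> \<mu> i"
    and mu_sum: "\<mu> False + \<mu> True = 1"
    and M: "prob_space M"
    and X_meas: "\<And>j i. X j i \<in> measurable M (count_space UNIV)"
    and X_law: "\<And>n k (s :: nat \<Rightarrow> nat \<Rightarrow> bool).
       measure M {\<omega> \<in> space M. \<forall>j<n. \<forall>i\<le>k. X j i \<omega> = s j i}
         = (\<Prod>j<n. \<mu> (s j 0) * (\<Prod>i<k. p (s j i) (s j (Suc i))))"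
  defines "B \<equiv> (\<lambda>n \<omega>. real (bucket_ops (\<lambda>j i. X j i \<omega>) n))"
    and "E \<equiv> (\<lambda>n. \<integral>\<omega>. real (bucket_ops (\<lambda>j i. X j i \<omega>) n) \<partial>M)"
    and "V \<equiv> (\<lambda>n. \<integral>\<omega>. (real (bucket_ops (\<lambda>j i. X j i \<omega>) n)
                 - (\<integral>\<omega>'. real (bucket_ops (\<lambda>j i. X j i \<omega>') n) \<partial>M))\<^sup>2 \<partial>M)"
  shows "((\<lambda>n. E n - real n * ln (real n) / entropy_rate p) \<in> O(\<lambda>n. real n))
    \<and> ((\<lambda>n. V n - sigma2 p * real n * ln (real n)) \<in> O(\<lambda>n. real n * sqrt (ln (real n))))
    \<and> weak_conv_m (\<lambda>n. distr M borel (\<lambda>\<omega>. (B n \<omega> - E n) / sqrt (V n)))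
           std_normal_distribution"
proof -
  interpret random_trie p \<mu> M X
    by (intro random_trie.intro markov_source.intro transition_matrix.intro markov_source_axioms.intro
        random_trie_axioms.intro M X_meas X_law mu_nonneg mu_sum p_stoch)
      (simp_all add: p_range)
  have "(\<lambda>n. E n - real n * ln (real n) / entropy_rate p) \<in> O(\<lambda>n. real n)"
  proof (rule bigoI)
    show "\<forall>\<^sub>F n in sequentially. norm (E n - real n * ln (real n) / entropy_rate p)
      \<le> (2 + defect_const + tau_const) * norm (real n)"
      using eventually_ge_at_top[of 2] unfolding E_def
      by eventually_elim (use expectation_ops in simp)
  qed
  moreover have "(\<lambda>n. V n - sigma2 p * real n * ln (real n)) \<in> O(\<lambda>n. real n * sqrt (ln (real n)))"
  proof (rule bigoI)
    show "\<forall>\<^sub>F n in sequentially. norm (V n - sigma2 p * real n * ln (real n))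
      \<le> ops_var_const * norm (real n * sqrt (ln (real n)))"
      using eventually_ge_at_top[of 3] unfolding V_def
      by eventually_elim (use variance_ops in \<open>simp add: mult.assoc\<close>)
  qed
  moreover have "weak_conv_m (\<lambda>n. distr M borel (\<lambda>\<omega>. (B n \<omega> - E n) / sqrt (V n))) std_normal_distribution"
    unfolding B_def E_def V_def using ops_asymptotic_normality[OF sigma2_pos[OF p_not_half]] .
  ultimately show ?thesis by blast
qed

end
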